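(* For all positive integers $k,m,r$, $$W_m(k+r-1,r)+(-1)^r W_k(m+r-1,r)=\sum_{j=1}^{r-1}(-1)^{j-1}\,T(\{1\}_{k-2},\bar 1,\{1\}_{j-1},\bar 1)\,T(\{1\}_{m-2},\bar 1,\{1\}_{r-j-1},\bar 1),$$ where by convention the string $(\{1\}_{-1},\bar 1)$ is empty (so for $k=1$ the first factor is $T(\{1\}_{j-1},\bar 1)$, and similarly for $m=1$).
   Context: $\{1\}_a$ denotes the sequence of $a$ ones. For positive integers $k_1,\dots,k_r$, where some entries may be marked with a bar, $T(\ldots)$ denotes $2^r\sum_{0<n_1<\cdots<n_r}\frac{\prod_{j\text{ barred}}(-1)^{n_j}}{(2n_1-1)^{k_1}(2n_2-2)^{k_2}\cdots(2n_r-r)^{k_r}}$. The alternating multiple $T$-value is $\bar T(k_1,\dots,k_r):=T(k_1,\dots,k_{r-1},\overline{k_r})$ (only the last entry barred), with $\bar T(\emptyset):=1$. $I(k,r)$ denotes the set of tuples $(k_1,\dots,k_r)$ of positive integers with $k_1+\cdots+k_r=k$. For a positive integer $m$, $W_m(k,r):=\sum_{(k_1,\dots,k_r)\in I(k,r)}\binom{k_r+m-2}{m-1}\bar T(k_1,\ldots,k_{r-1},k_r+m-1)$. *)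

theory Defs
  imports Complex_Main
begin

text \<open>An argument of T is a list of entries (k_j, barred_j), j = 1..r.
  Index sets: strictly increasing tuples 0 < n_1 < ... < n_r <= N.\<close>

definition idx_tuples :: "nat \<Rightarrow> nat \<Rightarrow> nat list set" where
  "idx_tuples r N = {ns. length ns = r \<and> sorted_wrt (<) ns \<and> (\<forall>n\<in>set ns. 0 < n \<and> n \<le> N)}"

definition T_part :: "(nat \<times> bool) list \<Rightarrow> nat \<Rightarrow> real" where
  "T_part ks N = 2 ^ length ks *
     (\<Sum>ns\<in>idx_tuples (length ks) N.
        \<Prod>i<length ks. (if snd (ks ! i) then (-1) ^ (ns ! i) else 1) /
                          (2 * real (ns ! i) - real (i + 1)) ^ fst (ks ! i))"

definition T_val :: "(nat \<times> bool) list \<Rightarrow> real" where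
  "T_val ks = lim (\<lambda>N. T_part ks N)"

definition Tbar :: "nat list \<Rightarrow> real" where
  "Tbar ks = (if ks = [] then 1
              else T_val (map (\<lambda>k. (k, False)) (butlast ks) @ [(last ks, True)]))"

definition compositions :: "nat \<Rightarrow> nat \<Rightarrow> nat list set" where
  "compositions k r = {ks. length ks = r \<and> (\<forall>x\<in>set ks. 0 < x) \<and> sum_list ks = k}"

definition W :: "nat \<Rightarrow> nat \<Rightarrow> nat \<Rightarrow> real" where
  "W m k r = (\<Sum>ks\<in>compositions k r.
      real ((last ks + m - 2) choose (m - 1)) * Tbar (butlast ks @ [last ks + m - 1]))"

definition pref :: "nat \<Rightarrow> (nat \<times> bool) list" where
  "pref k = (if k = 1 then [] else replicate (k - 2) (1, False) @ [(1, True)])"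

end

theory Submission
  imports Defs "HOL-Analysis.Analysis"
begin

text \<open>
  Put \<open>\<omega> = 2 dx / (1 + x\<^sup>2)\<close>. Up to the sign \<open>(-1)\<^sup>r\<close>, the value \<open>Tbar (k\<^sub>1, \<dots>, k\<^sub>r)\<close> is the value at 1 of
  the iterated integral of the forms \<open>\<omega>, (dx/x)\<^bsup>k\<^sub>1-1\<^esup>, \<dots>, \<omega>, (dx/x)\<^bsup>k\<^sub>r-1\<^esup>\<close>. Partial summation in the
  generating polynomials of the partial sums gives their derivatives up to an explicit remainder,
  and hence convergence up to \<open>x = 1\<close>.

  As functions of the upper limit \<open>x\<close>, both sides of the identity vanish at 0, and their derivatives
  are the same combinations of instances with smaller \<open>k + m + r\<close> (Pascal's rule on the side of \<open>W\<close>,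
  the product rule on the other side). So they agree by induction, with the products
  \<open>Tbar (1, \<dots>, 1, k) Tbar (1, \<dots>, 1, m)\<close> on the right.

  Finally, \<open>T ({1}\<^bsub>k-2\<^esub>, bar 1, {1}\<^bsub>j-1\<^esub>, bar 1)\<close> is \<open>(-1)\<^sup>j\<close> times the iterated integral of \<open>k - 1\<close> forms
  \<open>2 dx / (1 - x\<^sup>2)\<close> followed by \<open>j\<close> forms \<open>\<omega>\<close>. The substitution \<open>x \<mapsto> (1 - x) / (1 + x)\<close> exchanges
  \<open>2 dx / (1 - x\<^sup>2)\<close> with \<open>dx/x\<close>, preserves \<open>\<omega>\<close> and reverses the order, so the value
  is \<open>Tbar ({1}\<^bsub>j-1\<^esub>, k)\<close>.
\<close>

section \<open>Partial sums and their generating polynomials\<close>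

lemma idx_tuples_Suc:
  "idx_tuples (Suc r) N = (\<Union>n\<in>{1..N}. (\<lambda>ns. ns @ [n]) ` idx_tuples r (n - 1))"
proof (intro equalityI subsetI)
  fix ns assume ns: "ns \<in> idx_tuples (Suc r) N"
  then have "ns \<noteq> []" by (auto simp: idx_tuples_def)
  then obtain ms n where eq: "ns = ms @ [n]" by (metis rev_exhaust)
  have "ms \<in> idx_tuples r (n - 1)" "n \<in> {1..N}"
    using ns unfolding eq idx_tuples_def by (fastforce simp: sorted_wrt_append)+
  then show "ns \<in> (\<Union>n\<in>{1..N}. (\<lambda>ns. ns @ [n]) ` idx_tuples r (n - 1))"
    using eq by blast
next
  fix ns assume "ns \<in> (\<Union>n\<in>{1..N}. (\<lambda>ns. ns @ [n]) ` idx_tuples r (n - 1))"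
  then show "ns \<in> idx_tuples (Suc r) N"
    by (fastforce simp: idx_tuples_def sorted_wrt_append)
qed

lemma idx_tuples_0: "idx_tuples 0 N = {[]}"
  by (auto simp: idx_tuples_def)

lemma finite_idx_tuples: "finite (idx_tuples r N)"
proof (induction r arbitrary: N)
  case 0
  then show ?case by (simp add: idx_tuples_0)
qed (simp add: idx_tuples_Suc)

lemma T_part_Nil: "T_part [] N = 1"
  by (simp add: T_part_def idx_tuples_0)

lemma T_part_snoc:
  "T_part (L @ [(k, b)]) N =
     (\<Sum>n=1..N. 2 * (if b then (-1) ^ n else 1) / (2 * real n - real (length L + 1)) ^ k * T_part L (n - 1))"
proof -
  define l where "l = length L"
  define t where "t = (\<lambda>(M :: (nat \<times> bool) list) ns i.
    (if snd (M ! i) then (-1 :: real) ^ (ns ! i) else 1) / (2 * real (ns ! i) - real (i + 1)) ^ fst (M ! i))"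
  have t: "(\<Prod>i<Suc l. t (L @ [(k, b)]) (ms @ [n]) i) =
      (if b then (-1) ^ n else 1) / (2 * real n - real (l + 1)) ^ k * (\<Prod>i<l. t L ms i)"
    if "ms \<in> idx_tuples l m" for ms m n
  proof -
    have len: "length ms = l" using that by (simp add: idx_tuples_def)
    have "(\<Prod>i<l. t (L @ [(k, b)]) (ms @ [n]) i) = (\<Prod>i<l. t L ms i)"
      by (rule prod.cong) (auto simp: t_def nth_append l_def len)
    moreover have "t (L @ [(k, b)]) (ms @ [n]) l = (if b then (-1) ^ n else 1) / (2 * real n - real (l + 1)) ^ k"
      using len nth_append_length[of L "(k, b)" "[]"] nth_append_length[of ms n "[]"]
      by (simp add: t_def l_def)
    ultimately show ?thesis by simp
  qed
  have "T_part (L @ [(k, b)]) N =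
      2 ^ Suc l * (\<Sum>ns\<in>(\<Union>n\<in>{1..N}. (\<lambda>ns. ns @ [n]) ` idx_tuples l (n - 1)). \<Prod>i<Suc l. t (L @ [(k, b)]) ns i)"
    unfolding T_part_def t_def idx_tuples_Suc[symmetric] by (simp add: l_def)
  also have "(\<Sum>ns\<in>(\<Union>n\<in>{1..N}. (\<lambda>ns. ns @ [n]) ` idx_tuples l (n - 1)). \<Prod>i<Suc l. t (L @ [(k, b)]) ns i)
     = (\<Sum>n=1..N. \<Sum>ns\<in>(\<lambda>ns. ns @ [n]) ` idx_tuples l (n - 1). \<Prod>i<Suc l. t (L @ [(k, b)]) ns i)"
    by (rule sum.UNION_disjoint) (auto simp: finite_idx_tuples)
  also have "\<dots> = (\<Sum>n=1..N. \<Sum>ms\<in>idx_tuples l (n - 1). \<Prod>i<Suc l. t (L @ [(k, b)]) (ms @ [n]) i)"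
    by (intro sum.cong[OF refl], subst sum.reindex) (auto simp: inj_on_def)
  also have "\<dots> = (\<Sum>n=1..N. (if b then (-1) ^ n else 1) / (2 * real n - real (l + 1)) ^ k *
      (\<Sum>ms\<in>idx_tuples l (n - 1). \<Prod>i<l. t L ms i))"
    by (intro sum.cong refl, subst sum_distrib_left, intro sum.cong refl t)
  also have "2 ^ Suc l * \<dots> = (\<Sum>n=1..N. 2 * (if b then (-1) ^ n else 1) / (2 * real n - real (l + 1)) ^ k *
      (2 ^ l * (\<Sum>ms\<in>idx_tuples l (n - 1). \<Prod>i<l. t L ms i)))"
    unfolding sum_distrib_left[of "2 ^ Suc l"] by (intro sum.cong refl) simp
  finally show ?thesis unfolding T_part_def t_def l_def .
qed

lemma T_part_eq_0: "N < length L \<Longrightarrow> T_part L N = 0"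
proof (induction L arbitrary: N rule: rev_induct)
  case (snoc e L)
  obtain k b where e: "e = (k, b)" by fastforce
  show ?case unfolding e T_part_snoc using snoc by (intro sum.neutral) auto
qed simp

text \<open>The separate value at \<open>n = 0\<close> makes \<open>T_part L N\<close> the full sum
  of increments up to \<open>N\<close>. It is nonzero only for the empty list.\<close>

definition T_inc :: "(nat \<times> bool) list \<Rightarrow> nat \<Rightarrow> real" where
  "T_inc L n = (if n = 0 then T_part L 0 else T_part L n - T_part L (n - 1))"

lemma sum_T_inc: "(\<Sum>n\<le>N. T_inc L n) = T_part L N"
  by (induction N) (auto simp: T_inc_def)

lemma T_inc_snoc_0: "T_inc (L @ [e]) 0 = 0"
  by (simp add: T_inc_def T_part_eq_0)

lemma T_inc_snoc_Suc:
  "T_inc (L @ [(k, b)]) (Suc n) =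
     2 * (if b then (-1) ^ Suc n else 1) / (2 * real n + 1 - real (length L)) ^ k * T_part L n"
proof -
  have "2 * real (Suc n) - real (length L + 1) = 2 * real n + 1 - real (length L)" by simp
  then show ?thesis unfolding T_inc_def T_part_snoc by (simp del: of_nat_Suc of_nat_add)
qed

lemma T_inc_snoc_True: "T_inc (L @ [(k, True)]) n = (-1) ^ n * T_inc (L @ [(k, False)]) n"
  by (cases n) (simp_all add: T_inc_snoc_0 T_inc_snoc_Suc)

lemma T_inc_eq_0: "n < length L \<Longrightarrow> T_inc L n = 0"
  using T_part_eq_0[of 0 L] by (auto simp: T_inc_def T_part_eq_0)

lemma T_inc_Nil: "T_inc [] n = (if n = 0 then 1 else 0)"
  by (simp add: T_inc_def T_part_Nil)

text \<open>Evaluated at 1 with \<open>s = -1\<close> this puts, up to sign, a bar on the last entry of \<open>L\<close>. The truncated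
  subtraction in the exponent is harmless because \<open>T_inc L n = 0\<close> for \<open>n < length L\<close>.\<close>

definition gen_poly :: "real \<Rightarrow> (nat \<times> bool) list \<Rightarrow> nat \<Rightarrow> real \<Rightarrow> real" where
  "gen_poly s L N x = s ^ length L * (\<Sum>n\<le>N. s ^ n * T_inc L n * x ^ (2 * n - length L))"

lemma gen_poly_Nil: "gen_poly s [] N x = 1"
proof -
  have "(\<Sum>n\<le>N. s ^ n * T_inc [] n * x ^ (2 * n)) = (\<Sum>n\<le>N. if n = 0 then 1 else 0)"
    by (intro sum.cong) (auto simp: T_inc_Nil)
  then show ?thesis by (simp add: gen_poly_def)
qed

lemma gen_poly_0:
  assumes "L \<noteq> []" shows "gen_poly s L N 0 = 0"
proof -
  have "T_inc L n * 0 ^ (2 * n - length L) = 0" for n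
  proof (cases "n < length L")
    case False
    moreover have "0 < length L" using assms by simp
    ultimately have "0 < 2 * n - length L" by linarith
    then show ?thesis by simp
  qed (simp add: T_inc_eq_0)
  then have "(\<Sum>n\<le>N. s ^ n * T_inc L n * 0 ^ (2 * n - length L)) = 0"
    by (intro sum.neutral) (auto simp: mult.assoc)
  then show ?thesis unfolding gen_poly_def by simp
qed

lemma T_part_snoc_True_eq_gen_poly:
  "T_part (L @ [(k, True)]) N = (-1) ^ Suc (length L) * gen_poly (-1) (L @ [(k, False)]) N 1"
  unfolding sum_T_inc[symmetric] by (simp add: gen_poly_def T_inc_snoc_True flip: power_mult_distrib)

text \<open>The sign \<open>(-1) ^ n\<close> of the bar cancels the one from \<open>s = -1\<close>,
  so a barred last entry turns \<open>s = -1\<close> into \<open>s = 1\<close>. This is how the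
  forms \<open>2 dx / (1 - x^2)\<close> enter for the entries up to an inner bar.\<close>

lemma gen_poly_minus_snoc_True:
  "gen_poly (-1) (L @ [(k, True)]) N x = (-1) ^ Suc (length L) * gen_poly 1 (L @ [(k, False)]) N x"
proof -
  have "(-1) ^ n * T_inc (L @ [(k, True)]) n = T_inc (L @ [(k, False)]) n" for n
    unfolding T_inc_snoc_True by (simp flip: mult.assoc power_mult_distrib)
  then show ?thesis by (simp add: gen_poly_def)
qed

text \<open>Termwise: the exponent of \<open>x\<close> equals the denominator that belongs to the
  last entry, so \<open>x d/dx\<close> lowers the last exponent of the list by one.\<close>

lemma gen_poly_step_X:
  assumes "x \<noteq> 0"
  shows "(gen_poly s (L @ [(Suc k, False)]) N has_real_derivative gen_poly s (L @ [(k, False)]) N x / x) (at x)"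
proof -
  define r where "r = Suc (length L)"
  have len: "length (L @ [(a, b)]) = r" for a b by (simp add: r_def)
  have *: "T_inc (L @ [(Suc k, False)]) n * (real (2 * n - r) * x ^ (2 * n - r - 1)) =
      T_inc (L @ [(k, False)]) n * x ^ (2 * n - r) / x" for n
  proof (cases "n < r")
    case True
    then show ?thesis using T_inc_eq_0[of n "L @ [(_, False)]"] len by simp
  next
    case False
    then obtain m where n: "n = Suc m" by (cases n) (auto simp: r_def)
    define z where "z = 2 * n - r"
    have z: "z > 0" "real z = 2 * real m + 1 - real (length L)" using False n by (auto simp: r_def z_def)
    have "x ^ z = x * x ^ (z - 1)" using z(1) by (simp add: power_eq_if)
    then show ?thesis using z(1) assms
      unfolding z_def[symmetric] unfolding n T_inc_snoc_Suc z(2)[symmetric] by (simp add: field_simps)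
  qed
  have "((\<lambda>x. s ^ r * (\<Sum>n\<le>N. s ^ n * T_inc (L @ [(Suc k, False)]) n * x ^ (2 * n - r)))
     has_real_derivative s ^ r * (\<Sum>n\<le>N. s ^ n * T_inc (L @ [(Suc k, False)]) n * (real (2 * n - r) * x ^ (2 * n - r - 1)))) (at x)"
    by (auto intro!: derivative_eq_intros sum.cong)
  also have "s ^ r * (\<Sum>n\<le>N. s ^ n * T_inc (L @ [(Suc k, False)]) n * (real (2 * n - r) * x ^ (2 * n - r - 1)))
     = gen_poly s (L @ [(k, False)]) N x / x"
    unfolding gen_poly_def len mult.assoc * by (simp flip: sum_divide_distrib)
  finally show ?thesis unfolding gen_poly_def len .
qed

text \<open>Abel summation, since \<open>T_inc L\<close> is the difference sequence of
  \<open>T_part L\<close>. The boundary term becomes the remainder in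
  \<open>gen_poly_step_A\<close>.\<close>

lemma sum_by_parts_T_part:
  "(1 - s * x\<^sup>2) * (\<Sum>n\<le>N. s ^ n * T_part L n * x ^ (2 * n - length L)) =
   (\<Sum>n\<le>N. s ^ n * T_inc L n * x ^ (2 * n - length L)) - s ^ Suc N * T_part L N * x ^ (2 * N + 2 - length L)"
proof (induction N)
  case 0
  then show ?case using T_part_eq_0[of 0 L]
    by (cases L) (auto simp: T_inc_def power2_eq_square algebra_simps)
next
  case (Suc N)
  define l where "l = length L"
  \<comment> \<open>For \<open>Suc N < l\<close> truncated subtraction may spoil the relation
    between the exponents, but then the coefficient is 0.\<close>
  have e: "T_part L (Suc N) * x ^ (2 * Suc N + 2 - l) = T_part L (Suc N) * (x\<^sup>2 * x ^ (2 * Suc N - l))"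
  proof (cases "Suc N < l")
    case False
    then have "2 * Suc N + 2 - l = 2 + (2 * Suc N - l)" by simp
    then show ?thesis by (simp only: power_add)
  qed (simp add: T_part_eq_0 l_def)
  have e2: "2 * N + 2 - l = 2 * Suc N - l" by simp
  have i: "T_inc L (Suc N) = T_part L (Suc N) - T_part L N" by (simp add: T_inc_def)
  show ?case
    unfolding sum.atMost_Suc distrib_left Suc.IH[unfolded l_def[symmetric]] l_def[symmetric] e2 i mult.assoc e
    using Suc.IH by (simp add: algebra_simps l_def)
qed

text \<open>Differentiation removes the last denominator and leaves the coefficients
  \<open>T_part L n\<close>, which summation by parts turns back into increments. The form is
  \<omega> for \<open>s = -1\<close> and \<open>2 dx / (1 - x^2)\<close> for \<open>s = 1\<close>.
  The remainder need not tend to 0 at \<open>x = 1\<close>, but its primitive will be small.\<close>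

lemma gen_poly_step_A:
  assumes s: "s * s = 1" and x: "1 - s * x\<^sup>2 \<noteq> 0"
  shows "(gen_poly s (L @ [(1, False)]) (Suc N) has_real_derivative
     2 / (1 - s * x\<^sup>2) * (gen_poly s L N x - s ^ (length L + Suc N) * T_part L N * x ^ (2 * N + 2 - length L))) (at x)"
proof -
  define l where "l = length L"
  have *: "s ^ Suc n * T_inc (L @ [(1, False)]) (Suc n) * (real (2 * Suc n - Suc l) * x ^ (2 * Suc n - Suc l - 1)) =
      2 * s * (s ^ n * T_part L n * x ^ (2 * n - l))" for n
  proof (cases "n < l")
    case True
    then show ?thesis unfolding T_inc_snoc_Suc by (simp add: T_part_eq_0 l_def)
  next
    case False
    then have "real (2 * Suc n - Suc l) = 2 * real n + 1 - real l" "2 * Suc n - Suc l - 1 = 2 * n - l" by auto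
    moreover have "2 * real n + 1 - real l \<noteq> 0" using False by linarith
    ultimately show ?thesis unfolding T_inc_snoc_Suc l_def[symmetric] by simp
  qed
  have "((\<lambda>x. s ^ Suc l * (\<Sum>n\<le>Suc N. s ^ n * T_inc (L @ [(1, False)]) n * x ^ (2 * n - Suc l)))
     has_real_derivative s ^ Suc l * (\<Sum>n\<le>Suc N. s ^ n * T_inc (L @ [(1, False)]) n * (real (2 * n - Suc l) * x ^ (2 * n - Suc l - 1)))) (at x)"
    by (auto intro!: derivative_eq_intros sum.cong)
  also have "(\<Sum>n\<le>Suc N. s ^ n * T_inc (L @ [(1, False)]) n * (real (2 * n - Suc l) * x ^ (2 * n - Suc l - 1)))
      = 2 * s * (\<Sum>n\<le>N. s ^ n * T_part L n * x ^ (2 * n - l))"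
    unfolding sum.atMost_Suc_shift * by (simp add: T_inc_snoc_0 sum_distrib_left)
  also have "(\<Sum>n\<le>N. s ^ n * T_part L n * x ^ (2 * n - l)) =
     ((\<Sum>n\<le>N. s ^ n * T_inc L n * x ^ (2 * n - l)) - s ^ Suc N * T_part L N * x ^ (2 * N + 2 - l)) / (1 - s * x\<^sup>2)"
    using sum_by_parts_T_part[of s x L N] x by (simp add: field_simps l_def)
  also have "s ^ Suc l * (2 * s * \<dots>) = (s * s) * 2 / (1 - s * x\<^sup>2) * (gen_poly s L N x - s ^ (l + Suc N) * T_part L N * x ^ (2 * N + 2 - l))"
    unfolding gen_poly_def l_def[symmetric] power_add by (simp add: field_simps)
  finally show ?thesis using s by (simp add: gen_poly_def[abs_def] l_def)
qed

text \<open>Growth of smaller order than \<open>N\<close> is the goal, because integrating the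
  remainder \<open>x ^ M\<close> gains a factor \<open>1 / (M + 1)\<close>. An increment is at most
  \<open>2 / (n + 1)\<close> times \<open>8 ^ l * sqrt (n + 1)\<close>, hence at most
  \<open>8 ^ (l + 1) * (sqrt (n + 2) - sqrt (n + 1))\<close>, which telescopes.\<close>

lemma T_part_bound:
  assumes "\<forall>e\<in>set L. 0 < fst e"
  shows "\<bar>T_part L N\<bar> \<le> 8 ^ length L * sqrt (real (Suc N))"
  using assms
proof (induction L arbitrary: N rule: rev_induct)
  case Nil
  then show ?case by (simp add: T_part_Nil)
next
  case (snoc e L)
  obtain k b where e: "e = (k, b)" by fastforce
  have k: "k > 0" using snoc.prems e by simp
  define l where "l = length L"
  have T_inc: "\<bar>T_inc (L @ [e]) (Suc n)\<bar> \<le> 8 ^ Suc l * (sqrt (real (Suc (Suc n))) - sqrt (real (Suc n)))" for n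
  proof (cases "n < l")
    case True
    then show ?thesis unfolding e T_inc_snoc_Suc by (simp add: T_part_eq_0 l_def)
  next
    case False
    define a where "a = sqrt (real (Suc n))"
    define b' where "b' = sqrt (real (Suc (Suc n)))"
    define z where "z = 2 * real n + 1 - real l"
    have a: "a > 0" "a * a = real (Suc n)" "b' > 0" "b' * b' = real (Suc n) + 1"
      by (simp_all add: a_def b'_def)
    \<comment> \<open>From \<open>l \<le> n\<close> follows
      \<open>2 * n + 1 - l \<ge> n + 1\<close>.\<close>
    have z: "z \<ge> a * a" "z \<ge> 1" using False by (auto simp: z_def a)
    have "z ^ k \<ge> z ^ 1" using z k by (intro power_increasing) auto
    then have zk: "z ^ k \<ge> a * a" using z by simp
    have "b' * b' \<le> (2 * a) * (2 * a)" using a by simp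
    then have "b' \<le> 2 * a" using a by (meson less_eq_real_def mult_strict_mono not_le mult_pos_pos zero_less_numeral)
    then have ab: "b' + a \<le> 4 * a" using a by simp
    have "(b' - a) * (b' + a) = 1" using a by (simp add: algebra_simps)
    then have "b' - a = 1 / (b' + a)" using a by (simp add: field_simps)
    also have "\<dots> \<ge> 1 / (4 * a)" using ab a by (intro divide_left_mono mult_pos_pos) auto
    finally have d: "1 / (4 * a) \<le> b' - a" .
    have "\<bar>T_inc (L @ [e]) (Suc n)\<bar> = 2 / z ^ k * \<bar>T_part L n\<bar>"
      unfolding e T_inc_snoc_Suc l_def[symmetric] z_def[symmetric] using z by (simp add: abs_mult)
    also have "\<dots> \<le> 2 / (a * a) * (8 ^ l * a)"
      using snoc.IH[of n] snoc.prems zk a z unfolding a_def[symmetric] l_def[symmetric]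
      by (intro mult_mono divide_left_mono) (auto intro: mult_pos_pos)
    also have "\<dots> = 8 ^ Suc l * (1 / (4 * a))" using a(1) by (simp add: field_simps)
    also have "\<dots> \<le> 8 ^ Suc l * (b' - a)" using d by (intro mult_left_mono) auto
    finally show ?thesis unfolding a_def b'_def .
  qed
  show ?case
  proof (induction N)
    case 0
    then show ?case by (simp add: T_part_eq_0)
  next
    case (Suc N)
    have "T_part (L @ [e]) (Suc N) = T_part (L @ [e]) N + T_inc (L @ [e]) (Suc N)" by (simp add: T_inc_def)
    then show ?case using Suc T_inc[of N] by (simp add: l_def algebra_simps)
  qed
qed

section \<open>Iterated integrals and convergence\<close>

text \<open>Both \<open>g - f\<close> and \<open>g + f\<close> are nondecreasing. Derivatives are
  required only in the open interval, so singular endpoints are allowed, and every error estimate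
  below reduces to a bound on derivatives.\<close>

lemma abs_diff_le_if_abs_deriv_le:
  fixes f g :: "real \<Rightarrow> real"
  assumes "a \<le> b" "continuous_on {a..b} f" "continuous_on {a..b} g"
    and f: "\<And>x. a < x \<Longrightarrow> x < b \<Longrightarrow> (f has_real_derivative f' x) (at x)"
    and g: "\<And>x. a < x \<Longrightarrow> x < b \<Longrightarrow> (g has_real_derivative g' x) (at x)"
    and le: "\<And>x. a < x \<Longrightarrow> x < b \<Longrightarrow> \<bar>f' x\<bar> \<le> g' x"
  shows "\<bar>f b - f a\<bar> \<le> g b - g a"
proof -
  have "g a - f a \<le> g b - f b"
  proof (rule DERIV_nonneg_imp_increasing_open[OF \<open>a \<le> b\<close>])
    fix x assume x: "a < x" "x < b"
    show "\<exists>y. ((\<lambda>x. g x - f x) has_real_derivative y) (at x) \<and> 0 \<le> y"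
      using DERIV_diff[OF g[OF x] f[OF x]] le[OF x] by (intro exI[of _ "g' x - f' x"]) auto
  qed (intro continuous_intros assms)
  moreover have "g a + f a \<le> g b + f b"
  proof (rule DERIV_nonneg_imp_increasing_open[OF \<open>a \<le> b\<close>])
    fix x assume x: "a < x" "x < b"
    show "\<exists>y. ((\<lambda>x. g x + f x) has_real_derivative y) (at x) \<and> 0 \<le> y"
      using DERIV_add[OF g[OF x] f[OF x]] le[OF x] by (intro exI[of _ "g' x + f' x"]) auto
  qed (intro continuous_intros assms)
  ultimately show ?thesis by linarith
qed

section \<open>Integration operators and iterated integrals on [0, 1]\<close>

definition int_omega :: "(real \<Rightarrow> real) \<Rightarrow> real \<Rightarrow> real" where
  "int_omega F x = integral {0..x} (\<lambda>t. 2 / (1 + t\<^sup>2) * F t)"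

definition int_dlog :: "(real \<Rightarrow> real) \<Rightarrow> real \<Rightarrow> real" where
  "int_dlog F x = integral {0..x} (\<lambda>t. F t / t)"

text \<open>A class preserved by both integrations: vanishing at 0 with a one-sided derivative there
  makes \<open>F t / t\<close> extend continuously to 0, so integration against
  \<open>dt / t\<close> makes sense.\<close>

definition regular_at_0 :: "(real \<Rightarrow> real) \<Rightarrow> bool" where
  "regular_at_0 F \<longleftrightarrow> continuous_on {0..1} F \<and> F 0 = 0 \<and>
     (\<exists>D. (F has_real_derivative D) (at 0 within {0..1}))"

lemma regular_at_0_integral:
  fixes h :: "real \<Rightarrow> real"
  assumes h: "continuous_on {0..1} h" and F: "\<And>x. x \<in> {0..1} \<Longrightarrow> F x = integral {0..x} h"
  shows "regular_at_0 F"
    and "0 < x \<Longrightarrow> x < 1 \<Longrightarrow> (F has_real_derivative h x) (at x)"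
proof -
  have D: "(F has_real_derivative h x) (at x within {0..1})" if "x \<in> {0..1}" for x
    using integral_has_real_derivative[OF h that]
      has_derivative_transform[where g = F and f = "\<lambda>x. integral {0..x} h", OF that]
    unfolding has_field_derivative_def by (metis F)
  have "continuous_on {0..1} F"
    using D DERIV_isCont by (meson DERIV_continuous_on)
  then show "regular_at_0 F"
    unfolding regular_at_0_def using D[of 0] F[of 0] by auto
  assume "0 < x" "x < 1"
  then show "(F has_real_derivative h x) (at x)"
    using D[of x] at_within_interior[of x "{0..1}"] by (simp add: interior_atLeastAtMost_real)
qed

lemma int_omega_regular:
  assumes "continuous_on {0..1} F"
  shows "regular_at_0 (int_omega F)"
    and "0 < x \<Longrightarrow> x < 1 \<Longrightarrow> (int_omega F has_real_derivative 2 / (1 + x\<^sup>2) * F x) (at x)"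
proof -
  have "1 + t\<^sup>2 \<noteq> (0::real)" for t by (smt (verit) zero_le_power2)
  then have c: "continuous_on {0..1} (\<lambda>t. 2 / (1 + t\<^sup>2) * F t)"
    by (intro continuous_intros assms) auto
  show "regular_at_0 (int_omega F)"
    by (rule regular_at_0_integral(1)[OF c]) (simp add: int_omega_def)
  show "(int_omega F has_real_derivative 2 / (1 + x\<^sup>2) * F x) (at x)" if "0 < x" "x < 1"
    by (rule regular_at_0_integral(2)[OF c _ that]) (simp add: int_omega_def)
qed

lemma regular_at_0_quotient:
  assumes "regular_at_0 F"
  obtains h where "continuous_on {0..1} h" "\<And>x. x \<noteq> 0 \<Longrightarrow> h x = F x / x"
proof -
  obtain D where D: "(F has_real_derivative D) (at 0 within {0..1})" and F0: "F 0 = 0"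
    and c: "continuous_on {0..1} F" using assms by (auto simp: regular_at_0_def)
  define h where "h = (\<lambda>x. if x = 0 then D else F x / x)"
  have "continuous (at x within {0..1}) h" if x: "x \<in> {0..1}" for x
  proof (cases "x = 0")
    case True
    have "((\<lambda>t. F t / t) \<longlongrightarrow> D) (at 0 within {0..1})"
      using D F0 by (simp add: has_field_derivative_iff)
    then have "(h \<longlongrightarrow> D) (at 0 within {0..1})"
      by (rule Lim_transform_eventually) (auto simp: eventually_at_filter h_def)
    then show ?thesis by (simp add: True continuous_within h_def)
  next
    case False
    have "((\<lambda>t. F t / t) \<longlongrightarrow> F x / x) (at x within {0..1})"
      using c x False by (intro tendsto_intros) (auto simp: continuous_on_def)
    moreover have "\<forall>\<^sub>F t in at x within {0..1}. t \<noteq> 0"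
      using False by (intro tendsto_imp_eventually_ne[where c = x]) (auto intro: tendsto_ident_at)
    ultimately have "(h \<longlongrightarrow> F x / x) (at x within {0..1})"
      by (rule_tac Lim_transform_eventually) (auto elim: eventually_mono simp: h_def)
    then show ?thesis using False by (simp add: continuous_within h_def)
  qed
  then show ?thesis
    using that[of h] by (auto simp: continuous_on_eq_continuous_within h_def)
qed

text \<open>The integrand is replaced by its continuous extension; it changes only at the point 0,
  which does not affect the integral.\<close>

lemma int_dlog_regular:
  assumes "regular_at_0 F"
  shows "regular_at_0 (int_dlog F)"
    and "0 < x \<Longrightarrow> x < 1 \<Longrightarrow> (int_dlog F has_real_derivative F x / x) (at x)"
proof -
  obtain h where h: "continuous_on {0..1} h" "\<And>x. x \<noteq> 0 \<Longrightarrow> h x = F x / x"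
    using regular_at_0_quotient[OF assms] by blast
  have e: "int_dlog F x = integral {0..x} h" for x
    unfolding int_dlog_def by (rule integral_spike[of "{0}"]) (auto simp: h)
  show "regular_at_0 (int_dlog F)"
    by (rule regular_at_0_integral(1)[OF h(1) e])
  show "(int_dlog F has_real_derivative F x / x) (at x)" if "0 < x" "x < 1"
    using regular_at_0_integral(2)[OF h(1) e that] h(2)[of x] that by simp
qed

lemma regular_at_0_bound:
  assumes "regular_at_0 F"
  obtains C where "C \<ge> 0" "\<And>x. x \<in> {0..1} \<Longrightarrow> \<bar>F x\<bar> \<le> C * x"
proof -
  obtain h where h: "continuous_on {0..1} h" "\<And>x. x \<noteq> 0 \<Longrightarrow> h x = F x / x"
    using regular_at_0_quotient[OF assms] by blast
  have "bounded (h ` {0..1})"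
    by (intro compact_imp_bounded compact_continuous_image h) simp
  then obtain C where C: "C > 0" "\<And>x. x \<in> {0..1} \<Longrightarrow> \<bar>h x\<bar> \<le> C"
    unfolding bounded_pos by auto
  have "\<bar>F x\<bar> \<le> C * x" if "x \<in> {0..1}" for x
  proof (cases "x = 0")
    case True
    then show ?thesis using assms by (simp add: regular_at_0_def)
  next
    case False
    then have "\<bar>F x\<bar> = \<bar>h x\<bar> * x" using that h(2)[of x] by (simp add: abs_mult)
    then show ?thesis using C(2)[OF that] that by (simp add: mult_right_mono)
  qed
  then show ?thesis using that[of C] C by auto
qed

text \<open>Exponents are listed outermost first, so a composition \<open>ks\<close> corresponds to \<open>iter_int (rev ks)\<close>.\<close>

primrec iter_int :: "nat list \<Rightarrow> real \<Rightarrow> real" where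
  "iter_int [] = (\<lambda>x. 1)"
| "iter_int (k # ks) = (int_dlog ^^ (k - 1)) (int_omega (iter_int ks))"

lemma iter_int_regular: "continuous_on {0..1} (iter_int ks)" "regular_at_0 (iter_int (k # ks))"
proof -
  have *: "regular_at_0 (iter_int (k # ks))" if "continuous_on {0..1} (iter_int ks)" for k ks
  proof -
    have "regular_at_0 ((int_dlog ^^ n) (int_omega (iter_int ks)))" for n
      by (induction n) (auto intro: int_omega_regular int_dlog_regular that)
    then show ?thesis by simp
  qed
  show c: "continuous_on {0..1} (iter_int ks)"
  proof (induction ks)
    case (Cons k ks)
    then show ?case using * unfolding regular_at_0_def by blast
  qed simp
  show "regular_at_0 (iter_int (k # ks))" by (rule *[OF c])
qed

lemma iter_int_0: "iter_int (k # ks) 0 = 0"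
  using iter_int_regular(2) by (simp only: regular_at_0_def)

lemma iter_int_deriv_1:
  "0 < x \<Longrightarrow> x < 1 \<Longrightarrow> (iter_int (1 # ks) has_real_derivative 2 / (1 + x\<^sup>2) * iter_int ks x) (at x)"
  using int_omega_regular(2)[OF iter_int_regular(1)[of ks]] by simp

lemma iter_int_deriv_Suc:
  assumes "0 < k" "0 < x" "x < 1"
  shows "(iter_int (Suc k # ks) has_real_derivative iter_int (k # ks) x / x) (at x)"
proof -
  have "(int_dlog ^^ k) (int_omega (iter_int ks)) = int_dlog (iter_int (k # ks))"
    using assms by (cases k) auto
  then show ?thesis using int_dlog_regular(2)[OF iter_int_regular(2)[of k ks]] assms by simp
qed

section \<open>Uniform convergence of the generating polynomials\<close>

definition gen_poly_conv :: "(nat \<times> bool) list \<Rightarrow> (real \<Rightarrow> real) \<Rightarrow> bool" where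
  "gen_poly_conv L F \<longleftrightarrow> (\<forall>e>0. \<forall>\<^sub>F N in sequentially. \<forall>x\<in>{0..1}. \<bar>gen_poly (-1) L N x - F x\<bar> \<le> e)"

text \<open>The factor \<open>x\<close> in the error bound makes this mode of convergence stable under integration
  against \<open>dx / x\<close>; integration against \<open>2 dx / (1 + x\<^sup>2)\<close> turns plain uniform convergence into it.\<close>

definition gen_poly_conv_linear :: "(nat \<times> bool) list \<Rightarrow> (real \<Rightarrow> real) \<Rightarrow> bool" where
  "gen_poly_conv_linear L F \<longleftrightarrow> (\<forall>e>0. \<forall>\<^sub>F N in sequentially. \<forall>x\<in>{0..1}. \<bar>gen_poly (-1) L N x - F x\<bar> \<le> e * x)"

lemma gen_poly_conv_linear_imp_gen_poly_conv: "gen_poly_conv_linear L F \<Longrightarrow> gen_poly_conv L F"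
  unfolding gen_poly_conv_linear_def gen_poly_conv_def
proof (intro allI impI)
  fix e :: real assume e: "0 < e" and w: "\<forall>e>0. \<forall>\<^sub>F N in sequentially. \<forall>x\<in>{0..1}. \<bar>gen_poly (-1) L N x - F x\<bar> \<le> e * x"
  have "\<forall>\<^sub>F N in sequentially. \<forall>x\<in>{0..1}. \<bar>gen_poly (-1) L N x - F x\<bar> \<le> e * x" using w e by blast
  then show "\<forall>\<^sub>F N in sequentially. \<forall>x\<in>{0..1}. \<bar>gen_poly (-1) L N x - F x\<bar> \<le> e"
  proof eventually_elim
    case (elim N)
    have "e * x \<le> e" if "x \<in> {0..1}" for x using that e by (simp add: mult_left_le)
    then show ?case using elim by fastforce
  qed
qed

text \<open>Up to a constant factor, the remainder of \<open>gen_poly_step_A\<close> integrates to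
  at most \<open>\<bar>T_part L N\<bar> / (2 * N + 3 - length L)\<close>, and for
  \<open>length L \<le> N\<close> this denominator exceeds \<open>Suc N\<close>.\<close>

lemma T_part_small:
  assumes "\<forall>e\<in>set L. 0 < fst e" "e > 0"
  shows "\<forall>\<^sub>F N in sequentially. length L \<le> N \<and> \<bar>T_part L N\<bar> / real (Suc N) \<le> e"
proof -
  define c where "c = (8::real) ^ length L"
  have "(\<lambda>N. c * (1 / sqrt (real (Suc N)))) \<longlonglongrightarrow> c * 0"
    by (intro tendsto_mult tendsto_const tendsto_divide_0[OF tendsto_const] filterlim_compose[OF sqrt_at_top]
        filterlim_at_top_imp_at_infinity filterlim_compose[OF filterlim_real_sequentially filterlim_Suc])
  then have "\<forall>\<^sub>F N in sequentially. c * (1 / sqrt (real (Suc N))) < e"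
    using assms(2) by (intro order_tendstoD) auto
  with eventually_ge_at_top[of "length L"] show ?thesis
  proof eventually_elim
    case (elim N)
    have "\<bar>T_part L N\<bar> / real (Suc N) \<le> c * sqrt (real (Suc N)) / real (Suc N)"
      using T_part_bound[OF assms(1), of N] by (intro divide_right_mono) (auto simp: c_def)
    also have "\<dots> = c * (1 / sqrt (real (Suc N)))"
      using real_sqrt_mult_self[of "real (Suc N)"] by (simp add: field_simps del: of_nat_Suc)
    finally show ?case using elim by simp
  qed
qed

lemma continuous_on_gen_poly: "continuous_on A (gen_poly s L N)"
  unfolding gen_poly_def by (intro continuous_intros)

lemma gen_poly_conv_step_A:
  assumes L: "\<forall>e\<in>set L. 0 < fst e" and u: "gen_poly_conv L F"
    and c: "continuous_on {0..1} F2" and F0: "F2 0 = 0"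
    and d: "\<And>x. 0 < x \<Longrightarrow> x < 1 \<Longrightarrow> (F2 has_real_derivative 2 / (1 + x\<^sup>2) * F x) (at x)"
  shows "gen_poly_conv_linear (L @ [(1, False)]) F2"
  unfolding gen_poly_conv_linear_def
proof (intro allI impI)
  fix e :: real assume e: "e > 0"
  have "\<forall>\<^sub>F N in sequentially. \<forall>x\<in>{0..1}. \<bar>gen_poly (-1) L N x - F x\<bar> \<le> e / 4"
    using u e unfolding gen_poly_conv_def by (meson divide_pos_pos zero_less_numeral)
  moreover have "\<forall>\<^sub>F N in sequentially. length L \<le> N \<and> \<bar>T_part L N\<bar> / real (Suc N) \<le> e / 4"
    using e by (intro T_part_small[OF L]) auto
  ultimately have "\<forall>\<^sub>F N in sequentially. \<forall>x\<in>{0..1}. \<bar>gen_poly (-1) (L @ [(1, False)]) (Suc N) x - F2 x\<bar> \<le> e * x"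
  proof eventually_elim
    case (elim N)
    define M where "M = 2 * N + 2 - length L"
    define T where "T = \<bar>T_part L N\<bar>"
    have M: "Suc N \<le> Suc M" "M \<noteq> 0" using elim by (auto simp: M_def)
    show ?case
    proof
      fix x :: real assume x: "x \<in> {0..1}"
      define f where "f = (\<lambda>x. gen_poly (-1) (L @ [(1, False)]) (Suc N) x - F2 x)"
      \<comment> \<open>A primitive of the bound for the derivative of the error:
        \<open>2 / (1 + t^2) \<le> 2\<close> turns the error \<open>e / 4\<close> and the remainder
        into \<open>e / 2 + 2 * T * t ^ M\<close>. Since \<open>x ^ Suc M \<le> x\<close> on [0, 1],
        the result is linear in \<open>x\<close>.\<close>
      define g where "g = (\<lambda>x. (e / 2) * x + 2 * T / real (Suc M) * x ^ Suc M)"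
      have "\<bar>f x - f 0\<bar> \<le> g x - g 0"
      proof (rule abs_diff_le_if_abs_deriv_le)
        show "0 \<le> x" using x by simp
        show "continuous_on {0..x} f" unfolding f_def
          by (intro continuous_intros continuous_on_gen_poly continuous_on_subset[OF c]) (use x in auto)
        show "continuous_on {0..x} g" unfolding g_def by (intro continuous_intros)
        fix t :: real assume t: "0 < t" "t < x"
        have p: "1 - -1 * t\<^sup>2 \<noteq> 0" by (smt (verit) zero_le_power2)
        show "(f has_real_derivative 2 / (1 - -1 * t\<^sup>2) * (gen_poly (-1) L N t - (-1) ^ (length L + Suc N) * T_part L N * t ^ M)
            - 2 / (1 + t\<^sup>2) * F t) (at t)"
          unfolding f_def M_def using t x by (intro DERIV_diff gen_poly_step_A p d) auto
        show "(g has_real_derivative e / 2 + 2 * T * t ^ M) (at t)"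
          unfolding g_def by (rule derivative_eq_intros refl | simp)+
        have "\<bar>2 / (1 + t\<^sup>2) * (gen_poly (-1) L N t - F t - (-1) ^ (length L + Suc N) * T_part L N * t ^ M)\<bar>
            \<le> 2 * (e / 4 + T * t ^ M)"
          unfolding abs_mult
        proof (rule mult_mono)
          have "2 / (1 + t\<^sup>2) \<le> 2 / 1" by (intro divide_left_mono) (auto simp: add_pos_nonneg)
          then show "\<bar>2 / (1 + t\<^sup>2)\<bar> \<le> 2" by simp
          have "\<bar>gen_poly (-1) L N t - F t\<bar> \<le> e / 4" using elim t x by auto
          moreover have "\<bar>(-1) ^ (length L + Suc N) * T_part L N * t ^ M\<bar> = T * t ^ M"
            using t by (simp add: abs_mult T_def power_abs)
          ultimately show "\<bar>gen_poly (-1) L N t - F t - (-1) ^ (length L + Suc N) * T_part L N * t ^ M\<bar> \<le> e / 4 + T * t ^ M"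
            by linarith
        qed auto
        then show "\<bar>2 / (1 - -1 * t\<^sup>2) * (gen_poly (-1) L N t - (-1) ^ (length L + Suc N) * T_part L N * t ^ M)
            - 2 / (1 + t\<^sup>2) * F t\<bar> \<le> e / 2 + 2 * T * t ^ M"
          by (simp add: algebra_simps)
      qed
      moreover have "f 0 = 0" "g 0 = 0" by (auto simp: f_def g_def gen_poly_0 F0)
      moreover have "g x \<le> e * x"
      proof -
        have "2 * T / real (Suc M) \<le> 2 * T / real (Suc N)"
          using M by (intro divide_left_mono) (auto simp: T_def)
        also have "\<dots> = 2 * (T / real (Suc N))" by simp
        also have "\<dots> \<le> 2 * (e / 4)" using elim unfolding T_def by (intro mult_left_mono) auto
        finally have *: "2 * T / real (Suc M) \<le> e / 2" by simp
        have "x ^ Suc M \<le> x" using x by (simp add: mult_left_le power_le_one)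
        then have "2 * T / real (Suc M) * x ^ Suc M \<le> e / 2 * x"
          using * x e by (intro mult_mono) auto
        then show ?thesis by (simp add: g_def)
      qed
      ultimately show "\<bar>gen_poly (-1) (L @ [(1, False)]) (Suc N) x - F2 x\<bar> \<le> e * x"
        unfolding f_def by linarith
    qed
  qed
  then show "\<forall>\<^sub>F N in sequentially. \<forall>x\<in>{0..1}. \<bar>gen_poly (-1) (L @ [(1, False)]) N x - F2 x\<bar> \<le> e * x"
    by (simp only: eventually_sequentially_Suc[of "\<lambda>N. \<forall>x\<in>{0..1}. \<bar>gen_poly (-1) (L @ [(1, False)]) N x - F2 x\<bar> \<le> e * x"])
qed

lemma gen_poly_conv_linear_step_X:
  assumes w: "gen_poly_conv_linear (L @ [(k, False)]) F"
    and c: "continuous_on {0..1} F2" and F0: "F2 0 = 0"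
    and d: "\<And>x. 0 < x \<Longrightarrow> x < 1 \<Longrightarrow> (F2 has_real_derivative F x / x) (at x)"
  shows "gen_poly_conv_linear (L @ [(Suc k, False)]) F2"
  unfolding gen_poly_conv_linear_def
proof (intro allI impI)
  fix e :: real assume e: "e > 0"
  have "\<forall>\<^sub>F N in sequentially. \<forall>x\<in>{0..1}. \<bar>gen_poly (-1) (L @ [(k, False)]) N x - F x\<bar> \<le> e * x"
    using w e unfolding gen_poly_conv_linear_def by blast
  then show "\<forall>\<^sub>F N in sequentially. \<forall>x\<in>{0..1}. \<bar>gen_poly (-1) (L @ [(Suc k, False)]) N x - F2 x\<bar> \<le> e * x"
  proof eventually_elim
    case (elim N)
    show ?case
    proof
      fix x :: real assume x: "x \<in> {0..1}"
      define f where "f = (\<lambda>x. gen_poly (-1) (L @ [(Suc k, False)]) N x - F2 x)"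
      have "\<bar>f x - f 0\<bar> \<le> e * x - e * 0"
      proof (rule abs_diff_le_if_abs_deriv_le[where g = "\<lambda>x. e * x"])
        show "0 \<le> x" using x by simp
        show "continuous_on {0..x} f" unfolding f_def
          by (intro continuous_intros continuous_on_gen_poly continuous_on_subset[OF c]) (use x in auto)
        show "continuous_on {0..x} (\<lambda>x. e * x)" by (intro continuous_intros)
        fix t :: real assume t: "0 < t" "t < x"
        show "(f has_real_derivative gen_poly (-1) (L @ [(k, False)]) N t / t - F t / t) (at t)"
          unfolding f_def using t x by (intro DERIV_diff gen_poly_step_X d) auto
        show "((\<lambda>x. e * x) has_real_derivative e) (at t)"
          by (rule derivative_eq_intros refl | simp)+
        have "\<bar>gen_poly (-1) (L @ [(k, False)]) N t - F t\<bar> \<le> e * t" using elim t x by auto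
        then show "\<bar>gen_poly (-1) (L @ [(k, False)]) N t / t - F t / t\<bar> \<le> e"
          using t by (simp add: field_simps flip: diff_divide_distrib)
      qed
      moreover have "f 0 = 0" by (auto simp: f_def gen_poly_0 F0)
      ultimately show "\<bar>gen_poly (-1) (L @ [(Suc k, False)]) N x - F2 x\<bar> \<le> e * x" by (simp add: f_def)
    qed
  qed
qed

lemma gen_poly_conv_imp_T_val:
  assumes "gen_poly_conv (L @ [(k, False)]) F"
  shows "T_val (L @ [(k, True)]) = (-1) ^ Suc (length L) * F 1"
proof -
  have "(\<lambda>N. gen_poly (-1) (L @ [(k, False)]) N 1) \<longlonglongrightarrow> F 1"
    unfolding tendsto_iff
  proof (intro allI impI)
    fix e :: real assume e: "e > 0"
    then have "\<forall>\<^sub>F N in sequentially. \<forall>x\<in>{0..1}. \<bar>gen_poly (-1) (L @ [(k, False)]) N x - F x\<bar> \<le> e / 2"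
      using assms unfolding gen_poly_conv_def by (meson half_gt_zero)
    then show "\<forall>\<^sub>F N in sequentially. dist (gen_poly (-1) (L @ [(k, False)]) N 1) (F 1) < e"
    proof eventually_elim
      case (elim N)
      then have "\<bar>gen_poly (-1) (L @ [(k, False)]) N 1 - F 1\<bar> \<le> e / 2" by simp
      then show ?case using e by (simp add: dist_real_def)
    qed
  qed
  then have "(\<lambda>N. T_part (L @ [(k, True)]) N) \<longlonglongrightarrow> (-1) ^ Suc (length L) * F 1"
    unfolding T_part_snoc_True_eq_gen_poly by (intro tendsto_intros)
  then show ?thesis unfolding T_val_def by (rule limI)
qed

text \<open>Each entry \<open>k\<close> takes one integration against \<omega>, for which plain
  uniform convergence suffices, and then \<open>k - 1\<close> integrations against
  \<open>dx / x\<close>, which use the linear error bound.\<close>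

lemma gen_poly_conv_linear_iter_int:
  assumes "\<forall>k\<in>set (k # ks). 0 < k"
  shows "gen_poly_conv_linear (map (\<lambda>k. (k, False)) (rev (k # ks))) (iter_int (k # ks))"
proof -
  have *: "gen_poly_conv_linear (map (\<lambda>k. (k, False)) (rev ks) @ [(Suc n, False)]) (iter_int (Suc n # ks))"
    if u: "gen_poly_conv (map (\<lambda>k. (k, False)) (rev ks)) (iter_int ks)" and p: "\<forall>k\<in>set ks. 0 < k" for n ks
  proof (induction n)
    case 0
    show ?case unfolding One_nat_def[symmetric]
      by (rule gen_poly_conv_step_A[OF _ u iter_int_regular(1) iter_int_0 iter_int_deriv_1]) (use p in auto)
  next
    case (Suc n)
    show ?case
      by (rule gen_poly_conv_linear_step_X[OF Suc iter_int_regular(1) iter_int_0]) (rule iter_int_deriv_Suc, auto)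
  qed
  have u: "gen_poly_conv (map (\<lambda>k. (k, False)) (rev ks)) (iter_int ks)" if "\<forall>k\<in>set ks. 0 < k" for ks
    using that
  proof (induction ks)
    case Nil
    then show ?case by (simp add: gen_poly_conv_def gen_poly_Nil)
  next
    case (Cons k ks)
    then obtain n where "k = Suc n" by (cases k) auto
    then show ?case using gen_poly_conv_linear_imp_gen_poly_conv[OF *[of ks n]] Cons by simp
  qed
  obtain n where "k = Suc n" using assms by (cases k) auto
  then show ?thesis using *[of ks n] u[of ks] assms by simp
qed

lemma Tbar_eq_iter_int:
  assumes "\<forall>k\<in>set (k # ks). 0 < k"
  shows "Tbar (rev ks @ [k]) = (-1) ^ Suc (length ks) * iter_int (k # ks) 1"
  using gen_poly_conv_imp_T_val[OF gen_poly_conv_linear_imp_gen_poly_conv[OF gen_poly_conv_linear_iter_int[OF assms, simplified map_append rev.simps list.map]]]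
  by (simp add: Tbar_def)

section \<open>The shuffle identity\<close>

text \<open>Up to the factor \<open>(-1) ^ Suc i\<close>, the value at 1 is \<open>Tbar\<close> of
  \<open>i\<close> ones followed by \<open>Suc a\<close>.\<close>

definition ones_int :: "nat \<Rightarrow> nat \<Rightarrow> real \<Rightarrow> real" where
  "ones_int a i = iter_int (Suc a # replicate i 1)"

definition comp_sum_Cons :: "nat \<Rightarrow> nat \<Rightarrow> nat \<Rightarrow> real \<Rightarrow> real" where
  "comp_sum_Cons K r b x = (\<Sum>ks\<in>compositions K r. iter_int (b # rev ks) x)"

definition comp_sum :: "nat \<Rightarrow> nat \<Rightarrow> real \<Rightarrow> real" where
  "comp_sum K r x = (\<Sum>ks\<in>compositions K r. iter_int (rev ks) x)"

text \<open>At 1 this is \<open>W (Suc b) (a + Suc r) (Suc r)\<close> up to sign, grouped by the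
  last part \<open>i + 1\<close> of the composition; \<open>k\<close>, \<open>m\<close> and
  \<open>r\<close> of the theorem are shifted by one.\<close>

definition binom_comp_sum :: "nat \<Rightarrow> nat \<Rightarrow> nat \<Rightarrow> real \<Rightarrow> real" where
  "binom_comp_sum a b r x = (\<Sum>i\<le>a. real ((i + b) choose b) * comp_sum_Cons (a - i + r) r (i + b + 1) x)"

section \<open>Sums over compositions\<close>

lemma length_le_sum_list: "(\<forall>x\<in>set ks. 0 < x) \<Longrightarrow> length ks \<le> sum_list (ks :: nat list)"
  by (induction ks) auto

lemma finite_compositions: "finite (compositions K r)"
proof (rule finite_subset)
  show "compositions K r \<subseteq> {ks. set ks \<subseteq> {..K} \<and> length ks = r}"
    unfolding compositions_def using member_le_sum_list by fastforce
qed (rule finite_lists_length_eq, simp)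

lemma compositions_self: "compositions r r = {replicate r 1}"
proof -
  have "ks = replicate (length ks) 1" if "\<forall>x\<in>set ks. 0 < x" "sum_list ks = length ks" for ks :: "nat list"
    using that
  proof (induction ks)
    case (Cons k ks)
    then show ?case using length_le_sum_list[of ks] by auto
  qed simp
  then show ?thesis by (auto simp: compositions_def sum_list_replicate)
qed

lemma compositions_Suc:
  "compositions (a + Suc r) (Suc r) = (\<Union>i\<in>{..a}. (\<lambda>ks. ks @ [Suc i]) ` compositions (a - i + r) r)"
proof (intro equalityI subsetI)
  fix ks assume ks: "ks \<in> compositions (a + Suc r) (Suc r)"
  then have "ks \<noteq> []" by (auto simp: compositions_def)
  then obtain ms n where eq: "ks = ms @ [n]" by (metis rev_exhaust)
  have n: "0 < n" "length ms = r" "\<forall>x\<in>set ms. 0 < x" "sum_list ms + n = a + Suc r"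
    using ks unfolding eq compositions_def by auto
  have "r \<le> sum_list ms" using length_le_sum_list[of ms] n by simp
  then have "ms \<in> compositions (a - (n - 1) + r) r" "n - 1 \<in> {..a}" "ks = ms @ [Suc (n - 1)]"
    using n eq unfolding compositions_def by auto
  then show "ks \<in> (\<Union>i\<in>{..a}. (\<lambda>ks. ks @ [Suc i]) ` compositions (a - i + r) r)" by blast
next
  fix ks assume "ks \<in> (\<Union>i\<in>{..a}. (\<lambda>ks. ks @ [Suc i]) ` compositions (a - i + r) r)"
  then show "ks \<in> compositions (a + Suc r) (Suc r)" by (auto simp: compositions_def)
qed

lemma sum_compositions_Suc:
  fixes f :: "nat list \<Rightarrow> 'a::comm_monoid_add"
  shows "(\<Sum>ks\<in>compositions (a + Suc r) (Suc r). f ks) =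
     (\<Sum>i\<le>a. \<Sum>ks\<in>compositions (a - i + r) r. f (ks @ [Suc i]))"
proof -
  have "(\<Sum>ks\<in>compositions (a + Suc r) (Suc r). f ks) =
     (\<Sum>i\<le>a. \<Sum>ks\<in>(\<lambda>ks. ks @ [Suc i]) ` compositions (a - i + r) r. f ks)"
    unfolding compositions_Suc by (rule sum.UNION_disjoint) (auto simp: finite_compositions)
  also have "\<dots> = (\<Sum>i\<le>a. \<Sum>ks\<in>compositions (a - i + r) r. f (ks @ [Suc i]))"
    by (intro sum.cong[OF refl], subst sum.reindex) (auto simp: inj_on_def)
  finally show ?thesis .
qed

lemma W_eq_binom_comp_sum: "W (Suc b) (a + Suc r) (Suc r) = (-1) ^ Suc r * binom_comp_sum a b r 1"
proof -
  have *: "Tbar (ks @ [Suc (i + b)]) = (-1) ^ Suc r * iter_int (Suc (i + b) # rev ks) 1"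
    if "ks \<in> compositions K r" for ks K i
    using Tbar_eq_iter_int[of "Suc (i + b)" "rev ks"] that by (auto simp: compositions_def simp del: iter_int.simps)
  have "W (Suc b) (a + Suc r) (Suc r) =
     (\<Sum>i\<le>a. \<Sum>ks\<in>compositions (a - i + r) r. real ((i + b) choose b) * Tbar (ks @ [Suc (i + b)]))"
    unfolding W_def sum_compositions_Suc by simp
  also have "\<dots> = (\<Sum>i\<le>a. \<Sum>ks\<in>compositions (a - i + r) r. real ((i + b) choose b) * ((-1) ^ Suc r * iter_int (Suc (i + b) # rev ks) 1))"
    by (intro sum.cong refl) (simp add: * del: iter_int.simps)
  also have "\<dots> = (-1) ^ Suc r * binom_comp_sum a b r 1"
    by (simp add: binom_comp_sum_def comp_sum_Cons_def sum_distrib_left mult_ac del: iter_int.simps)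
  finally show ?thesis .
qed

lemma binom_comp_sum_0: "binom_comp_sum 0 b r = ones_int b r"
  by (simp add: binom_comp_sum_def comp_sum_Cons_def ones_int_def compositions_self fun_eq_iff del: iter_int.simps)

lemma comp_sum_Suc: "comp_sum (a + Suc r) (Suc r) x = binom_comp_sum a 0 r x"
  unfolding comp_sum_def sum_compositions_Suc by (simp add: binom_comp_sum_def comp_sum_Cons_def del: iter_int.simps)

lemma continuous_on_ones_int: "continuous_on {0..1} (ones_int a i)"
  unfolding ones_int_def by (rule iter_int_regular)

lemma ones_int_at_0: "ones_int a i 0 = 0"
  unfolding ones_int_def by (rule iter_int_0)

lemma ones_int_regular: "regular_at_0 (ones_int a i)"
  unfolding ones_int_def by (rule iter_int_regular)

lemma continuous_on_binom_comp_sum: "continuous_on {0..1} (binom_comp_sum a b r)"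
  unfolding binom_comp_sum_def comp_sum_Cons_def by (intro continuous_intros iter_int_regular)

lemma binom_comp_sum_at_0: "binom_comp_sum a b r 0 = 0"
  by (simp add: binom_comp_sum_def comp_sum_Cons_def iter_int_0 del: iter_int.simps)

section \<open>Derivatives with respect to the upper limit\<close>

context
  fixes x :: real
  assumes x: "0 < x" "x < 1"
begin

lemma ones_int_deriv_Suc: "(ones_int (Suc a) i has_real_derivative ones_int a i x / x) (at x)"
  unfolding ones_int_def using x by (intro iter_int_deriv_Suc) auto

lemma ones_int_deriv_0:
  "(ones_int 0 i has_real_derivative 2 / (1 + x\<^sup>2) * (if i = 0 then 1 else ones_int 0 (i - 1) x)) (at x)"
  using iter_int_deriv_1[OF x, of "replicate i 1"] by (cases i) (simp_all add: ones_int_def del: iter_int.simps, simp)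

lemma comp_sum_Cons_deriv_Suc: "0 < b \<Longrightarrow> (comp_sum_Cons K r (Suc b) has_real_derivative comp_sum_Cons K r b x / x) (at x)"
  unfolding comp_sum_Cons_def[abs_def] sum_divide_distrib using x by (intro DERIV_sum iter_int_deriv_Suc) auto

lemma comp_sum_Cons_deriv_1: "(comp_sum_Cons K r 1 has_real_derivative 2 / (1 + x\<^sup>2) * comp_sum K r x) (at x)"
  unfolding comp_sum_Cons_def[abs_def] comp_sum_def sum_distrib_left using x by (intro DERIV_sum iter_int_deriv_1) auto

text \<open>The outermost exponent is \<open>i + 1\<close>. The term \<open>i = 0\<close> loses its
  \<omega> and leaves a sum over compositions with \<open>r\<close> parts; every other term loses
  one \<open>dx / x\<close>, which shifts \<open>i\<close> down.\<close>

lemma binom_comp_sum_deriv_0: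
  "(binom_comp_sum a 0 r has_real_derivative (if a = 0 then 0 else binom_comp_sum (a - 1) 0 r x / x) + 2 / (1 + x\<^sup>2) * comp_sum (a + r) r x) (at x)"
proof (cases a)
  case 0
  then show ?thesis using comp_sum_Cons_deriv_1 by (simp add: binom_comp_sum_def[abs_def])
next
  case (Suc a')
  have "((\<lambda>x. comp_sum_Cons (a + r) r 1 x + (\<Sum>i\<le>a'. comp_sum_Cons (a' - i + r) r (Suc (Suc i)) x)) has_real_derivative
      2 / (1 + x\<^sup>2) * comp_sum (a + r) r x + (\<Sum>i\<le>a'. comp_sum_Cons (a' - i + r) r (Suc i) x / x)) (at x)"
    by (intro DERIV_add DERIV_sum comp_sum_Cons_deriv_1 comp_sum_Cons_deriv_Suc) auto
  then show ?thesis unfolding binom_comp_sum_def[abs_def] Suc sum.atMost_Suc_shift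
    by (simp add: sum_divide_distrib add.commute)
qed

text \<open>All outermost exponents exceed 1, so only \<open>dx / x\<close> is removed. Pascal's
  rule splits the coefficients; the half \<open>(i + b) choose Suc b\<close> vanishes at
  \<open>i = 0\<close> and shifts to the instance \<open>a - 1\<close>.\<close>

lemma binom_comp_sum_deriv_Suc:
  "(binom_comp_sum a (Suc b) r has_real_derivative (if a = 0 then 0 else binom_comp_sum (a - 1) (Suc b) r x / x) + binom_comp_sum a b r x / x) (at x)"
proof -
  have D: "(binom_comp_sum a (Suc b) r has_real_derivative
      (\<Sum>i\<le>a. real ((i + Suc b) choose Suc b) * (comp_sum_Cons (a - i + r) r (i + b + 1) x / x))) (at x)"
    unfolding binom_comp_sum_def[abs_def] using comp_sum_Cons_deriv_Suc
    by (intro DERIV_sum DERIV_cmult) auto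
  have "(\<Sum>i\<le>a. real ((i + Suc b) choose Suc b) * (comp_sum_Cons (a - i + r) r (i + b + 1) x / x)) =
      (\<Sum>i\<le>a. real ((i + b) choose Suc b) * (comp_sum_Cons (a - i + r) r (i + b + 1) x / x)) + binom_comp_sum a b r x / x"
    unfolding binom_comp_sum_def sum_divide_distrib sum.distrib[symmetric]
    by (intro sum.cong refl) (simp add: algebra_simps add_divide_distrib)
  also have "(\<Sum>i\<le>a. real ((i + b) choose Suc b) * (comp_sum_Cons (a - i + r) r (i + b + 1) x / x)) =
      (if a = 0 then 0 else binom_comp_sum (a - 1) (Suc b) r x / x)"
  proof (cases a)
    case (Suc a')
    then show ?thesis unfolding binom_comp_sum_def Suc sum.atMost_Suc_shift
      by (simp add: sum_divide_distrib)
  qed simp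
  finally show ?thesis using D by simp
qed

end

definition alt_prod_sum :: "nat \<Rightarrow> nat \<Rightarrow> nat \<Rightarrow> real \<Rightarrow> real" where
  "alt_prod_sum a b r x = (\<Sum>i<r. (-1) ^ i * (ones_int a i x * ones_int b (r - 1 - i) x))"

text \<open>Reversal of the summation. It matches the symmetry of the \<open>W\<close> side, so the
  case \<open>a = 0\<close> of the shuffle identity follows from the case
  \<open>b = 0\<close>.\<close>

lemma alt_prod_sum_sym: "alt_prod_sum b a r x = (-1) ^ Suc r * alt_prod_sum a b r x"
proof -
  have "alt_prod_sum b a r x = (\<Sum>i<r. (-1) ^ (r - Suc i) * (ones_int b (r - Suc i) x * ones_int a (r - 1 - (r - Suc i)) x))"
    unfolding alt_prod_sum_def by (rule sum.nat_diff_reindex[symmetric])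
  also have "\<dots> = (\<Sum>i<r. (-1) ^ Suc r * ((-1) ^ i * (ones_int a i x * ones_int b (r - 1 - i) x)))"
  proof (intro sum.cong refl)
    fix i assume "i \<in> {..<r}"
    then obtain j where j: "r = Suc (i + j)" by (metis lessThan_iff less_imp_Suc_add)
    show "(-1) ^ (r - Suc i) * (ones_int b (r - Suc i) x * ones_int a (r - 1 - (r - Suc i)) x) =
       (-1) ^ Suc r * ((-1) ^ i * (ones_int a i x * ones_int b (r - 1 - i) x))"
      unfolding j by (simp add: power_add flip: power_mult_distrib mult.assoc)
  qed
  finally show ?thesis by (simp add: alt_prod_sum_def sum_distrib_left)
qed

lemma eq_0_if_deriv_0:
  fixes f :: "real \<Rightarrow> real"
  assumes "continuous_on {0..1} f" "f 0 = 0"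
    and "\<And>x. 0 < x \<Longrightarrow> x < 1 \<Longrightarrow> (f has_real_derivative 0) (at x)" and x: "x \<in> {0..1}"
  shows "f x = 0"
proof -
  have "\<bar>f x - f 0\<bar> \<le> 0 - 0"
    by (rule abs_diff_le_if_abs_deriv_le[where f' = "\<lambda>_. 0" and g' = "\<lambda>_. 0" and g = "\<lambda>_. 0"])
      (use assms in \<open>auto intro: continuous_on_subset\<close>)
  then show ?thesis using assms by simp
qed

lemma continuous_on_alt_prod_sum: "continuous_on {0..1} (alt_prod_sum a b r)"
  unfolding alt_prod_sum_def by (intro continuous_intros continuous_on_ones_int)

lemma alt_prod_sum_at_0: "alt_prod_sum a b r 0 = 0"
  by (simp add: alt_prod_sum_def ones_int_at_0)

lemma alt_prod_sum_deriv:
  assumes "\<And>i. (ones_int a i has_real_derivative da i) (at x)" "\<And>i. (ones_int b i has_real_derivative db i) (at x)"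
  shows "(alt_prod_sum a b r has_real_derivative
     (\<Sum>i<r. (-1) ^ i * (da i * ones_int b (r - 1 - i) x)) + (\<Sum>i<r. (-1) ^ i * (ones_int a i x * db (r - 1 - i)))) (at x)"
  unfolding alt_prod_sum_def[abs_def] sum.distrib[symmetric]
  by (rule DERIV_sum) (auto intro!: derivative_eq_intros assms simp: algebra_simps)

text \<open>The difference \<open>f\<close> of the two sides vanishes at 0 and has derivative 0. If
  \<open>a\<close> and \<open>b\<close> are positive, the derivative lowers one of them; if exactly
  one is 0, an instance with smaller \<open>r\<close> appears as well; if both are 0, the derivative
  of the product sum telescopes.\<close>

lemma binom_comp_sum_shuffle:
  assumes "x \<in> {0..1}"
  shows "binom_comp_sum a b r x + (-1) ^ Suc r * binom_comp_sum b a r x = alt_prod_sum a b r x"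
  using assms
proof (induction "a + b + r" arbitrary: a b r x rule: less_induct)
  case less
  define f where "f = (\<lambda>a b r x. binom_comp_sum a b r x + (-1) ^ Suc r * binom_comp_sum b a r x - alt_prod_sum a b r x)"
  have IH: "f a' b' r' t = 0" if "a' + b' + r' < a + b + r" "0 < t" "t < 1" for a' b' r' t
    using less.hyps[OF that(1)] that by (simp add: f_def)
  have sym: "f b a r t = (-1) ^ Suc r * f a b r t" for a b r t
    unfolding f_def alt_prod_sum_sym[of b a] by (simp add: algebra_simps flip: mult.assoc power_mult_distrib)
  have cont: "continuous_on {0..1} (f a b r)" for a b r
    unfolding f_def by (intro continuous_intros continuous_on_binom_comp_sum continuous_on_alt_prod_sum)
  have at0: "f a b r 0 = 0" for a b r by (simp add: f_def binom_comp_sum_at_0 alt_prod_sum_at_0)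
  have D: "(f a b r has_real_derivative wa + (-1) ^ Suc r * wb - R) (at t)"
    if "(binom_comp_sum a b r has_real_derivative wa) (at t)" "(binom_comp_sum b a r has_real_derivative wb) (at t)"
      "(alt_prod_sum a b r has_real_derivative R) (at t)" for a b r wa wb R t
    unfolding f_def by (intro DERIV_add DERIV_diff DERIV_cmult that)
  \<comment> \<open>Only \<open>a + b\<close> is tied to \<open>a'\<close>, so this serves both for
    \<open>b = 0\<close> and, after exchanging the arguments, for \<open>a = 0\<close>.\<close>
  have one: "f (Suc a') 0 r x = 0" if eq: "a + b = Suc a'" and x: "x \<in> {0..1}" for a' x
  proof (rule eq_0_if_deriv_0[OF cont at0 _ x])
    fix t :: real assume t: "0 < t" "t < 1"
    define \<theta> where "\<theta> = 2 / (1 + t\<^sup>2)"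
    have s1: "(\<Sum>i<r. (-1) ^ i * (ones_int a' i t / t * ones_int 0 (r - 1 - i) t)) = alt_prod_sum a' 0 r t / t"
      by (simp add: alt_prod_sum_def sum_divide_distrib)
    \<comment> \<open>The \<omega> part is the instance for \<open>q = r - 1\<close>:
      \<open>comp_sum\<close> is \<open>binom_comp_sum (Suc a') 0 q\<close>, and its partner
      \<open>binom_comp_sum 0 (Suc a') q\<close> is \<open>ones_int (Suc a') q\<close>, which
      supplies the summand \<open>i = q\<close> missing from the smaller product sum.\<close>
    have s2: "(\<Sum>i<r. (-1) ^ i * (ones_int (Suc a') i t * (\<theta> * (if r - 1 - i = 0 then 1 else ones_int 0 (r - 1 - i - 1) t)))) =
        \<theta> * comp_sum (Suc a' + r) r t"
    proof (cases r)
      case 0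
      then show ?thesis by (simp add: comp_sum_def compositions_def)
    next
      case (Suc q)
      have "f (Suc a') 0 q t = 0" using IH[of "Suc a'" 0 q] t eq Suc by simp
      then have e: "binom_comp_sum (Suc a') 0 q t = alt_prod_sum (Suc a') 0 q t + (-1) ^ q * ones_int (Suc a') q t"
        by (simp add: f_def binom_comp_sum_0)
      have "(\<Sum>i<q. (-1) ^ i * (ones_int (Suc a') i t * (\<theta> * (if q - i = 0 then 1 else ones_int 0 (q - i - 1) t)))) =
         \<theta> * alt_prod_sum (Suc a') 0 q t"
        unfolding alt_prod_sum_def sum_distrib_left by (intro sum.cong) (auto simp: diff_right_commute)
      then show ?thesis unfolding Suc comp_sum_Suc e by (simp add: algebra_simps)
    qed
    have "f a' 0 r t = 0" using IH t eq by simp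
    then have e: "binom_comp_sum a' 0 r t / t + (-1) ^ Suc r * (binom_comp_sum 0 a' r t / t) - alt_prod_sum a' 0 r t / t = 0"
      unfolding f_def using t by (simp add: field_simps)
    show "(f (Suc a') 0 r has_real_derivative 0) (at t)"
      using D[OF binom_comp_sum_deriv_0[OF t, of "Suc a'" r] binom_comp_sum_deriv_Suc[OF t, of 0 a' r]
          alt_prod_sum_deriv[OF ones_int_deriv_Suc[OF t] ones_int_deriv_0[OF t]]] e
      unfolding \<theta>_def[symmetric] s1 s2 by (simp add: algebra_simps)
  qed
  have "f a b r x = 0"
  proof (cases a; cases b)
    fix a' b' assume ab: "a = Suc a'" "b = Suc b'"
    show ?thesis unfolding ab
    proof (rule eq_0_if_deriv_0[OF cont at0 _ less.prems])
      fix t :: real assume t: "0 < t" "t < 1"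
      have "f a' (Suc b') r t = 0" "f (Suc a') b' r t = 0" using IH t ab by simp_all
      then have e: "binom_comp_sum a' (Suc b') r t / t + (-1) ^ Suc r * (binom_comp_sum (Suc b') a' r t / t) - alt_prod_sum a' (Suc b') r t / t = 0"
        "binom_comp_sum (Suc a') b' r t / t + (-1) ^ Suc r * (binom_comp_sum b' (Suc a') r t / t) - alt_prod_sum (Suc a') b' r t / t = 0"
        unfolding f_def using t by (simp_all add: field_simps)
      have s: "(\<Sum>i<r. (-1) ^ i * (ones_int a' i t / t * ones_int (Suc b') (r - 1 - i) t)) = alt_prod_sum a' (Suc b') r t / t"
        "(\<Sum>i<r. (-1) ^ i * (ones_int (Suc a') i t * (ones_int b' (r - 1 - i) t / t))) = alt_prod_sum (Suc a') b' r t / t"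
        by (simp_all add: alt_prod_sum_def sum_divide_distrib)
      show "(f (Suc a') (Suc b') r has_real_derivative 0) (at t)"
        using D[OF binom_comp_sum_deriv_Suc[OF t, of "Suc a'" b' r] binom_comp_sum_deriv_Suc[OF t, of "Suc b'" a' r]
            alt_prod_sum_deriv[OF ones_int_deriv_Suc[OF t] ones_int_deriv_Suc[OF t]]] e
        unfolding s by (simp add: algebra_simps)
    qed
  next
    fix a' assume "a = Suc a'" "b = 0"
    then show ?thesis using one less.prems by simp
  next
    fix b' assume "a = 0" "b = Suc b'"
    then show ?thesis using one[of b' x] sym[of 0 b r x] less.prems by simp
  next
    assume ab: "a = 0" "b = 0"
    show ?thesis unfolding ab
    proof (rule eq_0_if_deriv_0[OF cont at0 _ less.prems])
      fix t :: real assume t: "0 < t" "t < 1"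
      define \<theta> where "\<theta> = 2 / (1 + t\<^sup>2)"
      \<comment> \<open>The integral of \<open>i\<close> forms \<omega>, equal to 1 for
        \<open>i = 0\<close>. With this convention both derivative sums merge into one telescoping
        sum.\<close>
      define P where "P = (\<lambda>i. if i = 0 then 1 else ones_int 0 (i - 1) t)"
      have "(\<Sum>i<r. (-1) ^ i * (\<theta> * P i * ones_int 0 (r - 1 - i) t)) + (\<Sum>i<r. (-1) ^ i * (ones_int 0 i t * (\<theta> * P (r - 1 - i))))
         = (\<Sum>i<r. \<theta> * ((-1) ^ i * P i * P (r - i)) - \<theta> * ((-1) ^ Suc i * P (Suc i) * P (r - Suc i)))"
        unfolding sum.distrib[symmetric]
        by (intro sum.cong) (auto simp: P_def algebra_simps)
      also have "\<dots> = \<theta> * ((-1) ^ 0 * P 0 * P (r - 0)) - \<theta> * ((-1) ^ r * P r * P (r - r))"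
        by (rule sum_lessThan_telescope')
      also have "\<dots> = \<theta> * P r + (-1) ^ Suc r * (\<theta> * P r)" by (simp add: P_def)
      finally have s: "(\<Sum>i<r. (-1) ^ i * (\<theta> * P i * ones_int 0 (r - 1 - i) t)) +
         (\<Sum>i<r. (-1) ^ i * (ones_int 0 i t * (\<theta> * P (r - 1 - i)))) = \<theta> * P r + (-1) ^ Suc r * (\<theta> * P r)" .
      have d: "(ones_int 0 i has_real_derivative \<theta> * P i) (at t)" for i
        unfolding P_def \<theta>_def by (rule ones_int_deriv_0[OF t])
      then have w: "(binom_comp_sum 0 0 r has_real_derivative \<theta> * P r) (at t)" unfolding binom_comp_sum_0 .
      show "(f 0 0 r has_real_derivative 0) (at t)"
        using D[OF w w alt_prod_sum_deriv[OF d d]] unfolding s by simp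
    qed
  qed
  then show ?case by (simp add: f_def)
qed

section \<open>Duality\<close>

text \<open>Closed form of the iterated integral of \<open>i\<close> forms
  \<open>2 dx / (1 - x^2)\<close> on \<open>[0, 1)\<close>.\<close>

definition log_power :: "nat \<Rightarrow> real \<Rightarrow> real" where
  "log_power i x = ln ((1 + x) / (1 - x)) ^ i / fact i"

definition cayley :: "real \<Rightarrow> real" where
  "cayley x = (1 - x) / (1 + x)"

lemma cayley_range: "0 < x \<Longrightarrow> x < 1 \<Longrightarrow> 0 < cayley x \<and> cayley x < 1" "x \<in> {0..1} \<Longrightarrow> cayley x \<in> {0..1}"
  by (auto simp: cayley_def field_simps)

lemma log_power_deriv_Suc:
  assumes "0 \<le> x" "x < 1"
  shows "(log_power (Suc i) has_real_derivative 2 / (1 - x\<^sup>2) * log_power i x) (at x)"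
proof -
  have uv: "1 - x\<^sup>2 = (1 + x) * (1 - x)" by (simp add: power2_eq_square algebra_simps)
  have e: "1 / (u / v) * (2 / v\<^sup>2) = 2 / (u * v)" if "u > 0" "v > 0" for u v :: real
    using that by (simp add: field_simps power2_eq_square)
  have q: "((\<lambda>x. (1 + x) / (1 - x)) has_real_derivative 2 / (1 - x)\<^sup>2) (at x)"
    using assms by (auto intro!: derivative_eq_intros simp: power2_eq_square)
  have "((\<lambda>x. ln ((1 + x) / (1 - x))) has_real_derivative 1 / ((1 + x) / (1 - x)) * (2 / (1 - x)\<^sup>2)) (at x)"
    using assms by (intro DERIV_chain2[OF DERIV_ln_divide q]) auto
  then have "((\<lambda>x. ln ((1 + x) / (1 - x))) has_real_derivative 2 / (1 - x\<^sup>2)) (at x)"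
    unfolding uv using assms by (subst (asm) e) auto
  from DERIV_power_Suc[OF this, of i]
  have "((\<lambda>x. ln ((1 + x) / (1 - x)) ^ Suc i) has_real_derivative
      real (Suc i) * (2 / (1 - x\<^sup>2)) * ln ((1 + x) / (1 - x)) ^ i) (at x)"
    by (simp only: of_nat_Suc mult.assoc add.commute)
  then have "((\<lambda>x. ln ((1 + x) / (1 - x)) ^ Suc i / fact (Suc i)) has_real_derivative
      real (Suc i) * (2 / (1 - x\<^sup>2)) * ln ((1 + x) / (1 - x)) ^ i / fact (Suc i)) (at x)"
    by (rule DERIV_cdivide)
  moreover have "real (Suc i) * (2 / (1 - x\<^sup>2)) * ln ((1 + x) / (1 - x)) ^ i / fact (Suc i) = 2 / (1 - x\<^sup>2) * log_power i x"
    unfolding log_power_def fact_Suc by (simp del: of_nat_Suc)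
  ultimately show ?thesis unfolding log_power_def[abs_def] by simp
qed

lemma log_power_0: "log_power 0 x = 1"
  by (simp add: log_power_def)

lemma log_power_at_0: "log_power i 0 = (if i = 0 then 1 else 0)"
  by (simp add: log_power_def)

section \<open>Pullback under the substitution \<open>cayley\<close>\<close>

lemma cayley_deriv:
  assumes "0 < x"
  shows "(cayley has_real_derivative - 2 / (1 + x)\<^sup>2) (at x)"
  unfolding cayley_def[abs_def] using assms
  by (auto intro!: derivative_eq_intros simp: field_simps power2_eq_square)

text \<open>For \<open>y = cayley x\<close>, \<open>dy / y = - 2 dx / (1 - x^2)\<close>.\<close>

lemma ones_int_cayley_deriv_Suc:
  assumes x: "0 < x" "x < 1"
  shows "((\<lambda>x. ones_int (Suc a) i (cayley x)) has_real_derivative - (2 / (1 - x\<^sup>2) * ones_int a i (cayley x))) (at x)"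
proof -
  have y: "0 < cayley x" "cayley x < 1" using cayley_range x by auto
  have "1 - x\<^sup>2 = (1 + x) * (1 - x)" by (simp add: power2_eq_square algebra_simps)
  moreover have "z / (v / u) * (- 2 / u\<^sup>2) = - (2 / (u * v) * z)" if "u > 0" "v > 0" for u v z :: real
    using that by (simp add: field_simps power2_eq_square)
  from this[of "1 + x" "1 - x" "ones_int a i (cayley x)"]
  have "ones_int a i (cayley x) / cayley x * (- 2 / (1 + x)\<^sup>2) = - (2 / ((1 + x) * (1 - x)) * ones_int a i (cayley x))"
    using x by (simp add: cayley_def)
  ultimately have "ones_int a i (cayley x) / cayley x * (- 2 / (1 + x)\<^sup>2) = - (2 / (1 - x\<^sup>2) * ones_int a i (cayley x))"
    by (simp only:)
  then show ?thesis
    using DERIV_chain2[OF ones_int_deriv_Suc[OF y] cayley_deriv[OF x(1)], of a i] by simp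
qed

text \<open>For \<open>y = cayley x\<close>, \<open>2 dy / (1 + y^2) = - 2 dx / (1 + x^2)\<close>;
  the sign reflects the reversal of the path.\<close>

lemma ones_int_cayley_deriv_0:
  assumes x: "0 < x" "x < 1"
  shows "((\<lambda>x. ones_int 0 i (cayley x)) has_real_derivative
     - (2 / (1 + x\<^sup>2) * (if i = 0 then 1 else ones_int 0 (i - 1) (cayley x)))) (at x)"
proof -
  have y: "0 < cayley x" "cayley x < 1" using cayley_range x by auto
  have "1 + (v / u)\<^sup>2 = (u\<^sup>2 + v\<^sup>2) / u\<^sup>2" if "u > 0" for u v :: real
    using that by (simp add: power_divide add_divide_distrib)
  from this[of "1 + x" "1 - x"] have "1 + (cayley x)\<^sup>2 = ((1 + x)\<^sup>2 + (1 - x)\<^sup>2) / (1 + x)\<^sup>2"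
    using x by (simp add: cayley_def)
  also have "(1 + x)\<^sup>2 + (1 - x)\<^sup>2 = 2 * (1 + x\<^sup>2)" by (simp add: power2_eq_square algebra_simps)
  finally have e: "1 + (cayley x)\<^sup>2 = 2 * (1 + x\<^sup>2) / (1 + x)\<^sup>2" .
  have "2 / (2 * A / B) * z * (- 2 / B) = - (2 / A * z)" if "A > 0" "B > 0" for A B z :: real
    using that by (simp add: field_simps)
  then have "2 / (1 + (cayley x)\<^sup>2) * z * (- 2 / (1 + x)\<^sup>2) = - (2 / (1 + x\<^sup>2) * z)" for z
    unfolding e using x by (metis add_pos_nonneg add_pos_pos zero_le_power2 zero_less_one zero_less_power)
  then show ?thesis
    using DERIV_chain2[OF ones_int_deriv_0[OF y] cayley_deriv[OF x(1)], of i] by simp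
qed

lemma tendsto_mult_ln_power_0: "((\<lambda>y::real. y * (- ln y) ^ i) \<longlongrightarrow> 0) (at_right 0)"
proof -
  have "LIM y at_right 0. - ln y :> (at_top :: real filter)"
    using ln_at_0 by (simp add: filterlim_uminus_at_top)
  then have "((\<lambda>y::real. (- ln y) ^ i / exp (- ln y)) \<longlongrightarrow> 0) (at_right 0)"
    by (rule filterlim_compose[OF tendsto_power_div_exp_0])
  then show ?thesis
    by (rule Lim_transform_eventually)
      (auto simp: eventually_at_filter exp_minus field_simps)
qed

text \<open>In the variable \<open>y = cayley x\<close> the logarithmic singularity at
  \<open>x = 1\<close> lies at \<open>y = 0\<close>, where \<open>ones_int\<close> is
  \<open>O(y)\<close> and outweighs every power of \<open>ln y\<close>.\<close>

lemma continuous_on_ln_power_mult_ones_int: "continuous_on {0..1} (\<lambda>y. (- ln y) ^ i / fact i * ones_int a j y)"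
proof -
  define h where "h = (\<lambda>y. (- ln y) ^ i / fact i * ones_int a j y)"
  have "continuous (at y within {0..1}) h" if y: "y \<in> {0..1}" for y
  proof (cases "y = 0")
    case False
    then have "(h \<longlongrightarrow> h y) (at y within {0..1})"
      using continuous_on_ones_int[of a j] y unfolding h_def by (intro tendsto_intros) (auto simp: continuous_on_def)
    then show ?thesis by (simp add: continuous_within)
  next
    case True
    obtain C where C: "C \<ge> 0" "\<And>x. x \<in> {0..1} \<Longrightarrow> \<bar>ones_int a j x\<bar> \<le> C * x"
      using regular_at_0_bound[OF ones_int_regular] by metis
    have at: "at (0::real) within {0..1} = at_right 0"
      using at_within_Icc_at_right[of 0 "1::real"] by simp
    have "((\<lambda>y. C / fact i * (y * (- ln y) ^ i)) \<longlongrightarrow> C / fact i * 0) (at_right 0)"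
      by (intro tendsto_intros tendsto_mult_ln_power_0)
    then have "(h \<longlongrightarrow> 0) (at_right 0)"
    proof (rule Lim_null_comparison[rotated, OF tendsto_eq_rhs])
      have "\<forall>\<^sub>F y::real in at_right 0. 0 < y \<and> y < 1"
        by (auto simp: eventually_at_right_field intro: exI[of _ 1])
      then show "\<forall>\<^sub>F y in at_right 0. norm (h y) \<le> C / fact i * (y * (- ln y) ^ i)"
      proof eventually_elim
        case (elim y)
        have "norm (h y) = (- ln y) ^ i / fact i * \<bar>ones_int a j y\<bar>"
          using elim by (simp add: h_def abs_mult power_abs)
        also have "\<dots> \<le> (- ln y) ^ i / fact i * (C * y)"
          using elim C(2)[of y] by (intro mult_left_mono) auto
        finally show ?case by (simp add: mult_ac)
      qed
    qed simp
    then show ?thesis unfolding True continuous_within at by (simp add: h_def ones_int_at_0)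
  qed
  then show ?thesis by (auto simp: continuous_on_eq_continuous_within h_def)
qed

lemma continuous_on_cayley: "continuous_on {0..1} cayley"
  unfolding cayley_def[abs_def] by (intro continuous_intros) auto

lemma continuous_on_ones_int_cayley: "continuous_on {0..1} (\<lambda>x. ones_int a i (cayley x))"
  by (rule continuous_on_compose2[OF continuous_on_ones_int continuous_on_cayley]) (use cayley_range in auto)

lemma continuous_on_log_power_mult_ones_int: "continuous_on {0..1} (\<lambda>x. log_power i x * ones_int a j (cayley x))"
proof -
  have "log_power i x = (- ln (cayley x)) ^ i / fact i" if "x \<in> {0..1}" for x
  proof -
    \<comment> \<open>This covers \<open>x = 1\<close> too: both quotients are then 0, and
      \<open>ln 0 = 0\<close>.\<close>
    have "ln ((1 + x) / (1 - x)) = - ln (cayley x)"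
      unfolding cayley_def ln_inverse[symmetric] by simp
    then show ?thesis by (simp add: log_power_def)
  qed
  then have "continuous_on {0..1} (\<lambda>x. log_power i x * ones_int a j (cayley x)) \<longleftrightarrow>
      continuous_on {0..1} (\<lambda>x. (- ln (cayley x)) ^ i / fact i * ones_int a j (cayley x))"
    by (intro continuous_on_cong) auto
  also have "\<dots>"
    by (rule continuous_on_compose2[OF continuous_on_ln_power_mult_ones_int continuous_on_cayley]) (use cayley_range in auto)
  finally show ?thesis .
qed

text \<open>\<open>dual_int p j\<close> is the iterated integral of \<open>p\<close> forms \<open>2 dx / (1 - x\<^sup>2)\<close> followed by \<open>j\<close> forms
  \<open>2 dx / (1 + x\<^sup>2)\<close>. The recursion is the path composition formula for \<open>[0, x]\<close> and \<open>[x, 1]\<close> solved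
  for the top term, where integrals over \<open>[x, 1]\<close> are moved to \<open>[0, cayley x]\<close>; its constant
  term is the value at 1, so the duality is built into the definition. At \<open>x = 1\<close> the junk values of
  \<open>log_power\<close> do not matter, since they are multiplied by \<open>ones_int _ _ 0 = 0\<close>.\<close>

fun dual_int :: "nat \<Rightarrow> nat \<Rightarrow> real \<Rightarrow> real" where
  "dual_int p 0 x = log_power p x"
| "dual_int p (Suc j) x = ones_int p j 1 - (\<Sum>i\<le>p. log_power i x * ones_int (p - i) j (cayley x))
     - (\<Sum>i<j. dual_int p (Suc i) x * ones_int 0 (j - 1 - i) (cayley x))"

declare dual_int.simps(2) [simp del]

lemma dual_int_Suc:
  "dual_int p (Suc j) = (\<lambda>x. ones_int p j 1 - (\<Sum>i\<le>p. log_power i x * ones_int (p - i) j (cayley x))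
     - (\<Sum>i<j. dual_int p (Suc i) x * ones_int 0 (j - 1 - i) (cayley x)))"
  by (rule ext) (rule dual_int.simps(2))

lemma dual_int_at_1: "dual_int p (Suc j) 1 = ones_int p j 1"
  unfolding dual_int_Suc[of p j] by (simp add: cayley_def ones_int_at_0)

text \<open>Only \<open>i = 0\<close> survives in the first sum, and \<open>cayley 0 = 1\<close>
  makes it cancel the constant; the second sum vanishes by induction. So \<open>dual_int\<close>
  starts at 0 like an iterated integral.\<close>

lemma dual_int_at_0: "dual_int p (Suc j) 0 = 0"
proof (induction j rule: less_induct)
  case (less j)
  have "(\<Sum>i\<le>p. log_power i 0 * ones_int (p - i) j 1) = (\<Sum>i\<le>p. if i = 0 then ones_int p j 1 else 0)"
    by (intro sum.cong) (auto simp: log_power_at_0)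
  moreover have "(\<Sum>i<j. dual_int p (Suc i) 0 * ones_int 0 (j - 1 - i) 1) = 0"
    using less by (intro sum.neutral) (auto)
  ultimately show ?case unfolding dual_int_Suc[of p j] by (simp add: cayley_def)
qed

lemma continuous_on_dual_int: "continuous_on {0..1} (dual_int p (Suc j))"
proof (induction j rule: less_induct)
  case (less j)
  have "continuous_on {0..1} (\<lambda>x. \<Sum>i<j. dual_int p (Suc i) x * ones_int 0 (j - 1 - i) (cayley x))"
    by (intro continuous_on_sum continuous_on_mult less continuous_on_ones_int_cayley) auto
  moreover have "continuous_on {0..1} (\<lambda>x. \<Sum>i\<le>p. log_power i x * ones_int (p - i) j (cayley x))"
    by (intro continuous_on_sum continuous_on_log_power_mult_ones_int)
  ultimately show ?case
    unfolding dual_int_Suc[of p j] by (intro continuous_on_diff continuous_on_const)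
qed

text \<open>Both sums telescope under the product rule. In the first, the parts with
  \<open>2 dx / (1 - x^2)\<close> cancel and only the \<omega> part at \<open>i = p\<close> remains.
  It is cancelled by the lower boundary term of the second, where
  \<open>dual_int p 0 = log_power p\<close>; the upper boundary term is the derivative
  claimed.\<close>

lemma dual_int_deriv:
  assumes x: "0 < x" "x < 1"
  shows "(dual_int p (Suc j) has_real_derivative 2 / (1 + x\<^sup>2) * dual_int p j x) (at x)"
proof (induction j rule: less_induct)
  case (less j)
  define \<theta> where "\<theta> = 2 / (1 + x\<^sup>2)"
  define \<beta> where "\<beta> = 2 / (1 - x\<^sup>2)"
  define P where "P = (\<lambda>i. if i = 0 then 1 else ones_int 0 (i - 1) (cayley x))"
  define db where "db = (\<lambda>i. \<beta> * (if i = 0 then 0 else log_power (i - 1) x))"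
  define dp where "dp = (\<lambda>a. if a = 0 then - (\<theta> * P j) else - (\<beta> * ones_int (a - 1) j (cayley x)))"
  have db: "(log_power i has_real_derivative db i) (at x)" for i
    using log_power_deriv_Suc[of x "i - 1"] x by (cases i) (auto simp: db_def \<beta>_def log_power_0[abs_def])
  have dp: "((\<lambda>x. ones_int a j (cayley x)) has_real_derivative dp a) (at x)" for a
    using ones_int_cayley_deriv_0[OF x, of j] ones_int_cayley_deriv_Suc[OF x, of "a - 1" j]
    by (cases a) (simp_all add: dp_def P_def \<theta>_def \<beta>_def)
  have dP: "((\<lambda>x. ones_int 0 i (cayley x)) has_real_derivative - (\<theta> * P i)) (at x)" for i
    using ones_int_cayley_deriv_0[OF x, of i] by (simp add: P_def \<theta>_def)
  have D1: "((\<lambda>x. \<Sum>i\<le>p. log_power i x * ones_int (p - i) j (cayley x)) has_real_derivative - (\<theta> * log_power p x * P j)) (at x)"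
  proof -
    have "((\<lambda>x. \<Sum>i\<le>p. log_power i x * ones_int (p - i) j (cayley x)) has_real_derivative
        (\<Sum>i\<le>p. db i * ones_int (p - i) j (cayley x) + dp (p - i) * log_power i x)) (at x)"
      by (intro DERIV_sum DERIV_mult db dp)
    also have "(\<Sum>i\<le>p. db i * ones_int (p - i) j (cayley x) + dp (p - i) * log_power i x) =
       (\<Sum>i<Suc p. db i * ones_int (p - i) j (cayley x)) + (\<Sum>i<Suc p. dp (p - i) * log_power i x)"
      by (simp only: sum.distrib lessThan_Suc_atMost)
    also have "(\<Sum>i<Suc p. db i * ones_int (p - i) j (cayley x)) = (\<Sum>i<p. \<beta> * log_power i x * ones_int (p - Suc i) j (cayley x))"
      unfolding sum.lessThan_Suc_shift by (simp add: db_def)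
    also have "(\<Sum>i<Suc p. dp (p - i) * log_power i x) = (\<Sum>i<p. - (\<beta> * log_power i x * ones_int (p - Suc i) j (cayley x))) - \<theta> * P j * log_power p x"
      by (simp add: dp_def mult_ac)
    finally show ?thesis by (simp add: sum_negf mult_ac)
  qed
  have D2: "((\<lambda>x. \<Sum>i<j. dual_int p (Suc i) x * ones_int 0 (j - 1 - i) (cayley x)) has_real_derivative
      \<theta> * (log_power p x * P j - dual_int p j x)) (at x)"
  proof -
    have "((\<lambda>x. \<Sum>i<j. dual_int p (Suc i) x * ones_int 0 (j - 1 - i) (cayley x)) has_real_derivative
       (\<Sum>i<j. \<theta> * dual_int p i x * ones_int 0 (j - 1 - i) (cayley x) + - (\<theta> * P (j - 1 - i)) * dual_int p (Suc i) x)) (at x)"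
      unfolding \<theta>_def by (intro DERIV_sum DERIV_mult dP[unfolded \<theta>_def] less.IH) simp
    also have "(\<Sum>i<j. \<theta> * dual_int p i x * ones_int 0 (j - 1 - i) (cayley x) + - (\<theta> * P (j - 1 - i)) * dual_int p (Suc i) x) =
       (\<Sum>i<j. \<theta> * (dual_int p i x * P (j - i)) - \<theta> * (dual_int p (Suc i) x * P (j - Suc i)))"
      by (intro sum.cong) (auto simp: P_def)
    also have "\<dots> = \<theta> * (dual_int p 0 x * P (j - 0)) - \<theta> * (dual_int p j x * P (j - j))"
      by (rule sum_lessThan_telescope')
    finally show ?thesis by (simp add: P_def algebra_simps)
  qed
  have "(dual_int p (Suc j) has_real_derivative 0 - - (\<theta> * log_power p x * P j) - \<theta> * (log_power p x * P j - dual_int p j x)) (at x)"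
    unfolding dual_int_Suc[of p j] by (intro DERIV_diff DERIV_const D1 D2)
  moreover have "0 - - (\<theta> * log_power p x * P j) - \<theta> * (log_power p x * P j - dual_int p j x) = \<theta> * dual_int p j x"
    by (simp add: algebra_simps)
  ultimately show ?case unfolding \<theta>_def by (simp only:)
qed

section \<open>Convergence for the doubly barred values\<close>

text \<open>Where the inner partial sum is nonzero, the denominator is positive. The sign makes the
  polynomials with \<open>s = 1\<close> increasing in \<open>N\<close> for
  \<open>x \<ge> 0\<close>.\<close>

lemma T_inc_unbarred_nonneg:
  assumes "\<forall>e\<in>set L. \<not> snd e"
  shows "T_inc L n \<ge> 0"
  using assms
proof (induction L arbitrary: n rule: rev_induct)
  case Nil
  then show ?case by (simp add: T_inc_Nil)
next
  case (snoc e L)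
  obtain k where e: "e = (k, False)" using snoc.prems by (cases e) auto
  have T: "T_part L m \<ge> 0" for m
    unfolding sum_T_inc[symmetric] using snoc by (intro sum_nonneg) auto
  show ?case
  proof (cases n)
    case 0
    then show ?thesis by (simp add: T_inc_snoc_0)
  next
    case (Suc m)
    then show ?thesis unfolding e Suc T_inc_snoc_Suc using T[of m] T_part_eq_0[of m L]
      by (cases "m < length L") auto
  qed
qed

text \<open>The form \<open>2 dx / (1 - x^2)\<close> is bounded on \<open>[0, x0]\<close> but not up
  to 1, hence the restriction to \<open>x0 < 1\<close>.\<close>

lemma gen_poly_unbarred_uniform_limit:
  assumes x0: "0 \<le> x0" "x0 < 1" and e: "0 < e"
  shows "\<forall>\<^sub>F N in sequentially. \<forall>x\<in>{0..x0}. \<bar>gen_poly 1 (replicate p (1, False)) N x - log_power p x\<bar> \<le> e"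
  using e
proof (induction p arbitrary: e)
  case 0
  then show ?case by (simp add: gen_poly_Nil log_power_0)
next
  case (Suc p)
  define L where "L = replicate p (1 :: nat, False)"
  have L: "replicate (Suc p) (1, False) = L @ [(1, False)]"
    unfolding L_def by (simp add: replicate_append_same)
  have x02: "x0\<^sup>2 < 1" using x0 by (simp add: power_less_one_iff)
  define \<beta> where "\<beta> = 2 / (1 - x0\<^sup>2)"
  have \<beta>: "\<beta> > 0" using x02 by (simp add: \<beta>_def)
  \<comment> \<open>Chosen so that the inner error and the remainder each contribute at most
    \<open>\<beta> * d = e / 2\<close>.\<close>
  define d where "d = e / (2 * \<beta>)"
  have d: "d > 0" "\<beta> * d = e / 2" using \<beta> Suc.prems by (auto simp: d_def)
  have "\<forall>\<^sub>F N in sequentially. \<forall>x\<in>{0..x0}. \<bar>gen_poly 1 L N x - log_power p x\<bar> \<le> d"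
    using Suc.IH[OF d(1)] by (simp add: L_def)
  moreover have "\<forall>\<^sub>F N in sequentially. length L \<le> N \<and> \<bar>T_part L N\<bar> / real (Suc N) \<le> d"
    using d by (intro T_part_small) (auto simp: L_def)
  ultimately have "\<forall>\<^sub>F N in sequentially. \<forall>x\<in>{0..x0}. \<bar>gen_poly 1 (L @ [(1, False)]) (Suc N) x - log_power (Suc p) x\<bar> \<le> e"
  proof eventually_elim
    case (elim N)
    define M where "M = 2 * N + 2 - length L"
    define T where "T = \<bar>T_part L N\<bar>"
    have M: "Suc N \<le> Suc M" using elim by (auto simp: M_def)
    show ?case
    proof
      fix x assume x: "x \<in> {0..x0}"
      define f where "f = (\<lambda>x. gen_poly 1 (L @ [(1, False)]) (Suc N) x - log_power (Suc p) x)"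
      define g where "g = (\<lambda>x. \<beta> * d * x + \<beta> * T / real (Suc M) * x ^ Suc M)"
      have Df: "(f has_real_derivative 2 / (1 - 1 * t\<^sup>2) * (gen_poly 1 L N t - 1 ^ (length L + Suc N) * T_part L N * t ^ M)
          - 2 / (1 - t\<^sup>2) * log_power p t) (at t)" if t: "0 \<le> t" "t < 1" for t
      proof -
        have "t\<^sup>2 < 1" using t by (simp add: power_less_one_iff)
        then show ?thesis
          unfolding f_def M_def using t by (intro DERIV_diff gen_poly_step_A log_power_deriv_Suc) auto
      qed
      have "\<bar>f x - f 0\<bar> \<le> g x - g 0"
      proof (rule abs_diff_le_if_abs_deriv_le)
        show "0 \<le> x" using x by simp
        show "continuous_on {0..x} f"
          by (rule continuous_at_imp_continuous_on) (use Df DERIV_isCont x x0 in fastforce)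
        show "continuous_on {0..x} g" unfolding g_def by (intro continuous_intros)
        fix t :: real assume t: "0 < t" "t < x"
        show "(f has_real_derivative 2 / (1 - 1 * t\<^sup>2) * (gen_poly 1 L N t - 1 ^ (length L + Suc N) * T_part L N * t ^ M)
          - 2 / (1 - t\<^sup>2) * log_power p t) (at t)"
          using t x x0 by (intro Df) auto
        show "(g has_real_derivative \<beta> * (d + T * t ^ M)) (at t)"
          unfolding g_def distrib_left by (rule derivative_eq_intros refl | simp)+
        have t2: "t\<^sup>2 \<le> x0\<^sup>2" using t x by (intro power_mono) auto
        have "\<bar>2 / (1 - t\<^sup>2) * (gen_poly 1 L N t - log_power p t - T_part L N * t ^ M)\<bar> \<le> \<beta> * (d + T * t ^ M)"
          unfolding abs_mult
        proof (rule mult_mono)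
          have "2 / (1 - t\<^sup>2) \<le> \<beta>" unfolding \<beta>_def using t2 x02 by (intro divide_left_mono) auto
          then show "\<bar>2 / (1 - t\<^sup>2)\<bar> \<le> \<beta>" using t2 x02 by simp
          have "\<bar>gen_poly 1 L N t - log_power p t\<bar> \<le> d" using elim t x by auto
          moreover have "\<bar>T_part L N * t ^ M\<bar> = T * t ^ M"
            using t by (simp add: abs_mult T_def)
          ultimately show "\<bar>gen_poly 1 L N t - log_power p t - T_part L N * t ^ M\<bar> \<le> d + T * t ^ M"
            by linarith
        qed (use \<beta> in auto)
        then show "\<bar>2 / (1 - 1 * t\<^sup>2) * (gen_poly 1 L N t - 1 ^ (length L + Suc N) * T_part L N * t ^ M)
          - 2 / (1 - t\<^sup>2) * log_power p t\<bar> \<le> \<beta> * (d + T * t ^ M)"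
          by (simp add: right_diff_distrib)
      qed
      moreover have "f 0 = 0" "g 0 = 0" by (auto simp: f_def g_def gen_poly_0 log_power_at_0)
      moreover have "g x \<le> e"
      proof -
        have "T / real (Suc M) \<le> T / real (Suc N)"
          using M by (intro divide_left_mono) (auto simp: T_def)
        also have "\<dots> \<le> d" using elim unfolding T_def by simp
        finally have "\<beta> * (T / real (Suc M)) \<le> \<beta> * d" using \<beta> by (intro mult_left_mono) auto
        moreover have "\<beta> * T / real (Suc M) * x ^ Suc M \<le> \<beta> * T / real (Suc M) * 1"
          using x x0 \<beta> by (intro mult_left_mono power_le_one) (auto simp: T_def)
        moreover have "\<beta> * d * x \<le> \<beta> * d * 1" using x x0 \<beta> d by (intro mult_left_mono) auto
        ultimately show ?thesis using d(2) unfolding g_def times_divide_eq_right by linarith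
      qed
      ultimately show "\<bar>gen_poly 1 (L @ [(1, False)]) (Suc N) x - log_power (Suc p) x\<bar> \<le> e"
        unfolding f_def by linarith
    qed
  qed
  then show ?case unfolding L
    by (simp only: eventually_sequentially_Suc[of "\<lambda>N. \<forall>x\<in>{0..x0}. \<bar>gen_poly 1 (L @ [(1, False)]) N x - log_power (Suc p) x\<bar> \<le> e"])
qed

text \<open>Nonnegative coefficients make the sequence increase to its limit, so every member lies
  below it.\<close>

lemma gen_poly_unbarred_bounds:
  assumes x: "0 \<le> x" "x < 1"
  shows "0 \<le> gen_poly 1 (replicate p (1, False)) N x" "gen_poly 1 (replicate p (1, False)) N x \<le> log_power p x"
proof -
  define L where "L = replicate p (1 :: nat, False)"
  have n: "T_inc L n * x ^ (2 * n - length L) \<ge> 0" for n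
    using x by (intro mult_nonneg_nonneg T_inc_unbarred_nonneg) (auto simp: L_def)
  show "0 \<le> gen_poly 1 (replicate p (1, False)) N x"
    unfolding L_def[symmetric] gen_poly_def using n by (simp add: sum_nonneg)
  have "incseq (\<lambda>N. gen_poly 1 L N x)"
    using n[of "Suc _"] by (intro incseq_SucI) (simp add: gen_poly_def)
  moreover have "(\<lambda>N. gen_poly 1 L N x) \<longlonglongrightarrow> log_power p x"
    unfolding tendsto_iff
  proof (intro allI impI)
    fix e :: real assume "e > 0"
    then have "\<forall>\<^sub>F N in sequentially. \<forall>t\<in>{0..x}. \<bar>gen_poly 1 L N t - log_power p t\<bar> \<le> e / 2"
      unfolding L_def by (intro gen_poly_unbarred_uniform_limit x) auto
    then show "\<forall>\<^sub>F N in sequentially. dist (gen_poly 1 L N x) (log_power p x) < e"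
    proof eventually_elim
      case (elim N)
      then have "\<bar>gen_poly 1 L N x - log_power p x\<bar> \<le> e / 2" using x by simp
      then show ?case using \<open>e > 0\<close> by (simp add: dist_real_def)
    qed
  qed
  ultimately show "gen_poly 1 (replicate p (1, False)) N x \<le> log_power p x"
    unfolding L_def by (rule incseq_le)
qed

text \<open>The inner generating polynomials increase to a function with a logarithmic singularity at 1.
  Monotonicity bounds the error near 1 by the small increment of its continuous primitive there.\<close>

lemma gen_poly_conv_dual_int_1:
  fixes p :: nat
  defines "L \<equiv> replicate p (1, False) @ [(1, True)]"
  shows "gen_poly_conv (L @ [(1, False)]) (\<lambda>x. (-1) ^ Suc p * dual_int (Suc p) 1 x)"
  unfolding gen_poly_conv_def
proof (intro allI impI)
  fix e :: real assume e: "e > 0"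
  define q where "q = dual_int (Suc p) 1"
  define S where "S = gen_poly 1 (replicate (Suc p) (1, False))"
  define \<sigma> where "\<sigma> = (-1 :: real) ^ Suc p"
  have \<sigma>: "\<bar>\<sigma>\<bar> = 1" by (simp add: \<sigma>_def)
  have GL: "gen_poly (-1) L N x = \<sigma> * S N x" for N x
    unfolding L_def S_def \<sigma>_def gen_poly_minus_snoc_True by (simp add: replicate_append_same)
  have cq: "continuous_on {0..1} q" unfolding q_def One_nat_def by (rule continuous_on_dual_int)
  have dq: "(q has_real_derivative 2 / (1 + t\<^sup>2) * log_power (Suc p) t) (at t)" if "0 < t" "t < 1" for t
    using dual_int_deriv[OF that, of "Suc p" 0] by (simp add: q_def)
  obtain \<delta> where \<delta>: "\<delta> > 0" "\<And>x. x \<in> {0..1} \<Longrightarrow> dist x 1 < \<delta> \<Longrightarrow> dist (q x) (q 1) < e / 8"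
    using cq e unfolding continuous_on_iff by (metis atLeastAtMost_iff divide_pos_pos le_numeral_extra(4) zero_le_one zero_less_numeral)
  \<comment> \<open>Within distance \<open>\<delta>\<close> of 1, so that \<open>q\<close> grows by
    at most \<open>e / 4\<close> on \<open>[x0, 1]\<close>; the maximum with \<open>1/2\<close>
    keeps \<open>x0\<close> positive.\<close>
  define x0 where "x0 = max (1/2) (1 - \<delta> / 2)"
  have x0: "0 < x0" "x0 < 1" "1 - \<delta> < x0" using \<delta>(1) by (auto simp: x0_def)
  have qx: "q x - q x0 \<le> e / 4" if "x \<in> {x0..1}" for x
  proof -
    have "dist (q x) (q 1) < e / 8" "dist (q x0) (q 1) < e / 8"
      using that x0 by (intro \<delta>(2); simp add: dist_real_def)+
    then show ?thesis unfolding dist_real_def by linarith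
  qed
  have "\<forall>\<^sub>F N in sequentially. \<forall>x\<in>{0..x0}. \<bar>S N x - log_power (Suc p) x\<bar> \<le> e / 8"
    unfolding S_def using x0 e by (intro gen_poly_unbarred_uniform_limit) auto
  moreover have "\<forall>\<^sub>F N in sequentially. length L \<le> N \<and> \<bar>T_part L N\<bar> / real (Suc N) \<le> e / 16"
    using e by (intro T_part_small) (auto simp: L_def)
  ultimately have "\<forall>\<^sub>F N in sequentially. \<forall>x\<in>{0..1}. \<bar>gen_poly (-1) (L @ [(1, False)]) (Suc N) x - \<sigma> * q x\<bar> \<le> e"
  proof eventually_elim
    case (elim N)
    define M where "M = 2 * N + 2 - length L"
    define T where "T = \<bar>T_part L N\<bar>"
    define h where "h = (\<lambda>x. 2 * T / real (Suc M) * x ^ Suc M)"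
    have M: "Suc N \<le> Suc M" using elim by (auto simp: M_def)
    have T0: "T \<ge> 0" by (simp add: T_def)
    have "2 * T / real (Suc M) \<le> 2 * T / real (Suc N)"
      using M T0 by (intro divide_left_mono) auto
    also have "\<dots> = 2 * (T / real (Suc N))" by simp
    also have "\<dots> \<le> 2 * (e / 16)" using elim unfolding T_def by (intro mult_left_mono) auto
    finally have TM: "2 * T / real (Suc M) \<le> e / 8" by simp
    have h: "0 \<le> h x" "h x \<le> e / 8" if "x \<in> {0..1}" for x
    proof -
      show "0 \<le> h x" using that T0 by (simp add: h_def)
      have "h x \<le> 2 * T / real (Suc M) * 1"
        unfolding h_def using that T0 by (intro mult_left_mono power_le_one) auto
      then show "h x \<le> e / 8" using TM by simp
    qed
    have Dh: "(h has_real_derivative 2 * T * t ^ M) (at t)" for t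
      unfolding h_def by (rule derivative_eq_intros refl | simp)+
    have ch: "continuous_on A h" for A unfolding h_def by (intro continuous_intros)
    define f where "f = (\<lambda>x. gen_poly (-1) (L @ [(1, False)]) (Suc N) x - \<sigma> * q x)"
    define f' where "f' = (\<lambda>t. 2 / (1 - -1 * t\<^sup>2) * (gen_poly (-1) L N t - (-1) ^ (length L + Suc N) * T_part L N * t ^ M)
      - \<sigma> * (2 / (1 + t\<^sup>2) * log_power (Suc p) t))"
    have Df: "(f has_real_derivative f' t) (at t)" if t: "0 < t" "t < 1" for t
    proof -
      have "1 - -1 * t\<^sup>2 \<noteq> 0" by (smt (verit) zero_le_power2)
      then show ?thesis
        unfolding f_def f'_def M_def using t by (intro DERIV_diff gen_poly_step_A DERIV_cmult dq) auto
    qed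
    have cf: "continuous_on {0..1} f"
      unfolding f_def by (intro continuous_intros continuous_on_gen_poly cq)
    have f': "\<bar>f' t\<bar> \<le> 2 / (1 + t\<^sup>2) * \<bar>S N t - log_power (Suc p) t\<bar> + 2 * T * t ^ M" if t: "0 < t" "t < 1" for t
    proof -
      have p: "0 < 1 + t\<^sup>2" by (simp add: add_pos_nonneg)
      then have "2 / (1 + t\<^sup>2) \<le> 2 / 1" by (intro divide_left_mono) auto
      then have le: "2 / (1 + t\<^sup>2) * (T * t ^ M) \<le> 2 * (T * t ^ M)"
        using T0 t by (intro mult_right_mono) auto
      have "f' t = 2 / (1 + t\<^sup>2) * (\<sigma> * (S N t - log_power (Suc p) t)) - 2 / (1 + t\<^sup>2) * ((-1) ^ (length L + Suc N) * T_part L N * t ^ M)"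
        unfolding f'_def GL by (simp add: algebra_simps)
      also have "\<bar>\<dots>\<bar> \<le> \<bar>2 / (1 + t\<^sup>2) * (\<sigma> * (S N t - log_power (Suc p) t))\<bar> + \<bar>2 / (1 + t\<^sup>2) * ((-1) ^ (length L + Suc N) * T_part L N * t ^ M)\<bar>"
        by (rule abs_triangle_ineq4)
      also have "\<bar>2 / (1 + t\<^sup>2) * (\<sigma> * (S N t - log_power (Suc p) t))\<bar> = 2 / (1 + t\<^sup>2) * \<bar>S N t - log_power (Suc p) t\<bar>"
        unfolding abs_mult \<sigma> using p by simp
      also have "\<bar>2 / (1 + t\<^sup>2) * ((-1) ^ (length L + Suc N) * T_part L N * t ^ M)\<bar> = 2 / (1 + t\<^sup>2) * (T * t ^ M)"
        unfolding abs_mult power_abs T_def using p t by simp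
      finally show ?thesis using le by simp
    qed
    have f0: "f 0 = 0" using dual_int_at_0[of "Suc p" 0] by (simp add: f_def q_def gen_poly_0)
    \<comment> \<open>Uniform convergence of \<open>S N\<close> on \<open>[0, x0]\<close>
      contributes \<open>e / 4\<close> and the remainder \<open>e / 8\<close>.\<close>
    have low: "\<bar>f x\<bar> \<le> 3 * e / 8" if x: "x \<in> {0..x0}" for x
    proof -
      have "\<bar>f x - f 0\<bar> \<le> (e / 4 * x + h x) - (e / 4 * 0 + h 0)"
      proof (rule abs_diff_le_if_abs_deriv_le[where f' = f' and g = "\<lambda>x. e / 4 * x + h x"])
        show "0 \<le> x" using x by simp
        show "continuous_on {0..x} f" using x x0 by (intro continuous_on_subset[OF cf]) auto
        show "continuous_on {0..x} (\<lambda>x. e / 4 * x + h x)" by (intro continuous_intros ch)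
        fix t assume t: "0 < t" "t < x"
        show "(f has_real_derivative f' t) (at t)" using t x x0 by (intro Df) auto
        show "((\<lambda>x. e / 4 * x + h x) has_real_derivative e / 4 + 2 * T * t ^ M) (at t)"
          by (rule derivative_eq_intros refl Dh | simp)+
        have "2 / (1 + t\<^sup>2) \<le> 2 / 1" by (intro divide_left_mono) (auto simp: add_pos_nonneg)
        then have "2 / (1 + t\<^sup>2) * \<bar>S N t - log_power (Suc p) t\<bar> \<le> 2 * (e / 8)"
          using elim t x by (intro mult_mono) auto
        then show "\<bar>f' t\<bar> \<le> e / 4 + 2 * T * t ^ M" using f'[of t] t x x0 by simp
      qed
      moreover have "e / 4 * x \<le> e / 4 * 1" using x x0 e by (intro mult_left_mono) auto
      ultimately show ?thesis using h(2)[of x] h(1)[of 0] x x0 f0 by simp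
    qed
    \<comment> \<open>In place of convergence, \<open>S N\<close> lies between 0 and
      \<open>log_power (Suc p)\<close>, so the derivative of the error is bounded by that of
      \<open>q + h\<close>, which grows by at most \<open>e / 4 + e / 8\<close>.\<close>
    have high: "\<bar>f x - f x0\<bar> \<le> 3 * e / 8" if x: "x \<in> {x0..1}" for x
    proof -
      have "\<bar>f x - f x0\<bar> \<le> (q x + h x) - (q x0 + h x0)"
      proof (rule abs_diff_le_if_abs_deriv_le[where f' = f' and g = "\<lambda>x. q x + h x"])
        show "x0 \<le> x" using x by simp
        show "continuous_on {x0..x} f" using x x0 by (intro continuous_on_subset[OF cf]) auto
        show "continuous_on {x0..x} (\<lambda>x. q x + h x)"
          using x x0 by (intro continuous_intros ch continuous_on_subset[OF cq]) auto
        fix t assume t: "x0 < t" "t < x"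
        then have t': "0 < t" "t < 1" using x x0 by auto
        show "(f has_real_derivative f' t) (at t)" by (rule Df[OF t'])
        show "((\<lambda>x. q x + h x) has_real_derivative 2 / (1 + t\<^sup>2) * log_power (Suc p) t + 2 * T * t ^ M) (at t)"
          by (intro DERIV_add dq[OF t'] Dh)
        have "\<bar>S N t - log_power (Suc p) t\<bar> \<le> log_power (Suc p) t"
          using gen_poly_unbarred_bounds[of t "Suc p" N] t' unfolding S_def by linarith
        then have "2 / (1 + t\<^sup>2) * \<bar>S N t - log_power (Suc p) t\<bar> \<le> 2 / (1 + t\<^sup>2) * log_power (Suc p) t"
          by (intro mult_left_mono) (auto simp: add_pos_nonneg)
        then show "\<bar>f' t\<bar> \<le> 2 / (1 + t\<^sup>2) * log_power (Suc p) t + 2 * T * t ^ M" using f'[OF t'] by simp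
      qed
      then show ?thesis using qx[OF x] h(2)[of x] h(1)[of x0] x x0 by simp
    qed
    show ?case
    proof
      fix x :: real assume x: "x \<in> {0..1}"
      have "\<bar>f x\<bar> \<le> e"
      proof (cases "x \<le> x0")
        case True
        then show ?thesis using low[of x] x e by simp
      next
        case False
        then have "\<bar>f x - f x0\<bar> \<le> 3 * e / 8" "\<bar>f x0\<bar> \<le> 3 * e / 8"
          using high[of x] low[of x0] x x0 by simp_all
        then show ?thesis using e by linarith
      qed
      then show "\<bar>gen_poly (-1) (L @ [(1, False)]) (Suc N) x - \<sigma> * q x\<bar> \<le> e" by (simp only: f_def)
    qed
  qed
  then show "\<forall>\<^sub>F N in sequentially. \<forall>x\<in>{0..1}. \<bar>gen_poly (-1) (L @ [(1, False)]) N x - (-1) ^ Suc p * dual_int (Suc p) 1 x\<bar> \<le> e"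
    unfolding \<sigma>_def q_def
    by (simp only: eventually_sequentially_Suc[of "\<lambda>N. \<forall>x\<in>{0..1}. \<bar>gen_poly (-1) (L @ [(1, False)]) N x - (-1) ^ Suc p * dual_int (Suc p) 1 x\<bar> \<le> e"])
qed

text \<open>Only the first \<omega> after the bar meets the singular integrand. Its integral is
  continuous on [0, 1], so \<open>gen_poly_conv_step_A\<close> handles all further ones.\<close>

lemma gen_poly_conv_dual_int:
  fixes p :: nat
  defines "L \<equiv> replicate p (1, False) @ [(1, True)]"
  shows "gen_poly_conv (L @ replicate (Suc j) (1, False)) (\<lambda>x. (-1) ^ Suc p * dual_int (Suc p) (Suc j) x)"
proof (induction j)
  case 0
  then show ?case using gen_poly_conv_dual_int_1[of p] by (simp add: L_def)
next
  case (Suc j)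
  have "gen_poly_conv_linear ((L @ replicate (Suc j) (1, False)) @ [(1, False)]) (\<lambda>x. (-1) ^ Suc p * dual_int (Suc p) (Suc (Suc j)) x)"
  proof (rule gen_poly_conv_step_A[OF _ Suc])
    show "\<forall>e\<in>set (L @ replicate (Suc j) (1, False)). 0 < fst e" by (auto simp: L_def)
    show "continuous_on {0..1} (\<lambda>x. (-1) ^ Suc p * dual_int (Suc p) (Suc (Suc j)) x)"
      by (intro continuous_intros continuous_on_dual_int)
    show "(-1) ^ Suc p * dual_int (Suc p) (Suc (Suc j)) 0 = 0" by (simp add: dual_int_at_0)
    fix x :: real assume "0 < x" "x < 1"
    from DERIV_cmult[OF dual_int_deriv[OF this], of "(-1) ^ Suc p"]
    show "((\<lambda>x. (-1) ^ Suc p * dual_int (Suc p) (Suc (Suc j)) x) has_real_derivative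
        2 / (1 + x\<^sup>2) * ((-1) ^ Suc p * dual_int (Suc p) (Suc j) x)) (at x)"
      by (simp only: mult.left_commute)
  qed
  then show ?case
    by (simp add: gen_poly_conv_linear_imp_gen_poly_conv replicate_append_same)
qed

text \<open>For \<open>k = 1\<close> there is no inner bar and the value is directly an iterated
  integral. For \<open>k \<ge> 2\<close> it is a value of \<open>dual_int\<close> at 1, where
  duality gives \<open>ones_int\<close>; the signs from the inner bar cancel, leaving the same
  form.\<close>

lemma T_val_pref:
  assumes "0 < k"
  shows "T_val (pref k @ replicate j (1, False) @ [(1, True)]) = (-1) ^ Suc j * ones_int (k - 1) j 1"
proof (cases "k = 1")
  case True
  have "gen_poly_conv_linear (replicate j (1, False) @ [(1, False)]) (ones_int 0 j)"
    using gen_poly_conv_linear_iter_int[of 1 "replicate j 1"] by (simp add: ones_int_def map_replicate_const del: iter_int.simps)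
  from gen_poly_conv_imp_T_val[OF gen_poly_conv_linear_imp_gen_poly_conv[OF this]] show ?thesis
    using True by (simp add: pref_def)
next
  case False
  define p where "p = k - 2"
  have k: "k = Suc (Suc p)" using False assms by (simp add: p_def)
  define L where "L = replicate p (1 :: nat, False) @ [(1, True)]"
  have "gen_poly_conv ((L @ replicate j (1, False)) @ [(1, False)]) (\<lambda>x. (-1) ^ Suc p * dual_int (Suc p) (Suc j) x)"
    using gen_poly_conv_dual_int[of p j] unfolding L_def by (simp add: replicate_append_same)
  from gen_poly_conv_imp_T_val[OF this]
  have "T_val ((L @ replicate j (1, False)) @ [(1, True)]) =
      (-1) ^ Suc (Suc p + j) * ((-1) ^ Suc p * ones_int (Suc p) j 1)"
    unfolding dual_int_at_1 by (simp add: L_def)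
  also have "(-1) ^ Suc (Suc p + j) * ((-1) ^ Suc p * ones_int (Suc p) j 1) = (-1) ^ Suc j * ones_int (Suc p) j 1"
    by (simp add: power_add)
  finally show ?thesis by (simp add: k pref_def L_def)
qed

theorem theorem1p3:
  fixes k m r :: nat
  assumes "0 < k" "0 < m" "0 < r"
  shows "W m (k + r - 1) r + (-1) ^ r * W k (m + r - 1) r =
    (\<Sum>j = 1..r - 1. (-1) ^ (j - 1) *
        T_val (pref k @ replicate (j - 1) (1, False) @ [(1, True)]) *
        T_val (pref m @ replicate (r - j - 1) (1, False) @ [(1, True)]))"
proof -
  obtain a b q where eqs: "k = Suc a" "m = Suc b" "r = Suc q"
    using assms by (metis gr0_implies_Suc)
  have "W m (k + r - 1) r + (-1) ^ r * W k (m + r - 1) r =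
      (-1) ^ r * (binom_comp_sum a b q 1 + (-1) ^ Suc q * binom_comp_sum b a q 1)"
    using W_eq_binom_comp_sum[of b a q] W_eq_binom_comp_sum[of a b q] by (simp add: eqs algebra_simps)
  also have "\<dots> = (-1) ^ r * alt_prod_sum a b q 1"
    by (subst binom_comp_sum_shuffle) simp_all
  \<comment> \<open>With \<open>r = q + 1\<close>, the sign \<open>(-1) ^ r\<close> splits into
    \<open>(-1) ^ Suc i\<close> and \<open>(-1) ^ (q - i)\<close>, the signs of the two
    \<open>T_val\<close> factors.\<close>
  also have "\<dots> = (\<Sum>i<q. (-1) ^ i * ((-1) ^ Suc i * ones_int a i 1) * ((-1) ^ (q - i) * ones_int b (q - 1 - i) 1))"
    unfolding alt_prod_sum_def sum_distrib_left
  proof (intro sum.cong refl)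
    fix i assume "i \<in> {..<q}"
    then obtain j where j: "q = i + j" by (metis lessThan_iff less_imp_add_positive)
    show "(-1) ^ r * ((-1) ^ i * (ones_int a i 1 * ones_int b (q - 1 - i) 1)) =
       (-1) ^ i * ((-1) ^ Suc i * ones_int a i 1) * ((-1) ^ (q - i) * ones_int b (q - 1 - i) 1)"
      unfolding eqs j by (simp add: power_add)
  qed
  also have "\<dots> = (\<Sum>i<q. (-1) ^ i *
        T_val (pref k @ replicate i (1, False) @ [(1, True)]) *
        T_val (pref m @ replicate (q - 1 - i) (1, False) @ [(1, True)]))"
  proof (intro sum.cong refl)
    fix i assume "i \<in> {..<q}"
    then have "Suc (q - 1 - i) = q - i" by auto
    then show "(-1) ^ i * ((-1) ^ Suc i * ones_int a i 1) * ((-1) ^ (q - i) * ones_int b (q - 1 - i) 1) =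
        (-1) ^ i * T_val (pref k @ replicate i (1, False) @ [(1, True)]) *
        T_val (pref m @ replicate (q - 1 - i) (1, False) @ [(1, True)])"
      unfolding T_val_pref[OF assms(1)] T_val_pref[OF assms(2)] by (simp only: eqs diff_Suc_1)
  qed
  also have "\<dots> = (\<Sum>j = 1..r - 1. (-1) ^ (j - 1) *
        T_val (pref k @ replicate (j - 1) (1, False) @ [(1, True)]) *
        T_val (pref m @ replicate (r - j - 1) (1, False) @ [(1, True)]))"
    by (rule sum.reindex_bij_witness[of _ "\<lambda>j. j - 1" Suc]) (auto simp: eqs)
  finally show ?thesis .
qed

end
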